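(* Let $\gamma\in(0,2)$ and let $\mu,\nu$ be probability distributions on $\mathbb R^d$ with finite $\gamma$-th absolute moment. Then for $(X,Y)\sim\mu\otimes\nu$, $$\mathcal E_\gamma^2(\mu,\nu)=\frac1{S_\gamma}\int_{\mathbb S^{d-1}}\int_{\mathbb R}\Big[\mathbb E\,\psi_\gamma(\langle X,v\rangle-b)-\mathbb E\,\psi_\gamma(\langle Y,v\rangle-b)\Big]^2\,db\,d\sigma(v),$$ where $$S_\gamma=\frac{\pi^{\frac d2+1}\,\Gamma(1-\frac\gamma2)}{\gamma\,2^{\gamma-1}\,\Gamma(\frac{d+\gamma}2)\,\cos^2\!\big(\frac{\pi(\gamma-1)}4\big)\,\Gamma(\frac{1-\gamma}2)^2}\quad(\gamma\ne1),\qquad S_1=\frac{\pi^{\frac{d-1}2}}{\Gamma(\frac{d+1}2)} .$$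
   Context: $\sigma$ is the unnormalized surface measure on $\mathbb S^{d-1}$ (counting measure on $\{\pm1\}$ if $d=1$). For $\gamma\in(0,2)$, $\psi_\gamma:\mathbb R\to\mathbb R$ is $\psi_\gamma(x)=|x|^{(\gamma-1)/2}$ if $\gamma\neq1$, and $\psi_1(x)=\mathbf 1\{x\ge0\}$. The generalized energy distance $\mathcal E_\gamma(\mu,\nu)\ge0$ is given by $\mathcal E_\gamma^2(\mu,\nu)=\mathbb E\big[2\|X-Y\|^\gamma-\|X-X'\|^\gamma-\|Y-Y'\|^\gamma\big]$ with $(X,X',Y,Y')\sim\mu^{\otimes2}\otimes\nu^{\otimes2}$. *)

theory Defs
  imports "HOL-Probability.Probability"
begin

text \<open>
  The unnormalized surface measure on the unit sphere of a Euclidean space of dimension \<open>d\<close>: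
  a Borel set \<open>A\<close> of unit vectors has measure \<open>d\<close> times the Lebesgue measure of the cone
  \<open>{r v | v \<in> A, 0 < r \<le> 1}\<close> (polar coordinates). Below, Lebesgue measure on the
  punctured unit ball is pushed forward along the radial projection; the cone formula and the
  case of the counting measure for \<open>d = 1\<close> are checked afterwards.
\<close>

definition sphere_measure :: "'a::euclidean_space measure" where
  "sphere_measure =
     scale_measure (ennreal (real DIM('a)))
       (distr (restrict_space lborel (cball 0 1 - {0}))
              (restrict_space borel (sphere 0 1))
              (\<lambda>x. x /\<^sub>R norm x))"

lemma sets_sphere_measure [measurable_cong]:
  "sets (sphere_measure :: 'a::euclidean_space measure) = sets (restrict_space borel (sphere 0 1))"
  by (simp add: sphere_measure_def)

lemma space_sphere_measure: "space (sphere_measure :: 'a::euclidean_space measure) = sphere 0 1"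
  using sets_eq_imp_space_eq[OF sets_sphere_measure] by (simp add: space_restrict_space)

lemma measurable_radial_projection:
  "(\<lambda>x::'a::euclidean_space. x /\<^sub>R norm x)
     \<in> measurable (restrict_space lborel (cball 0 1 - {0})) (restrict_space borel (sphere 0 1))"
proof (rule measurable_restrict_space2)
  show "(\<lambda>x::'a. x /\<^sub>R norm x) \<in> space (restrict_space lborel (cball 0 1 - {0})) \<rightarrow> sphere 0 1"
    by (auto simp: space_restrict_space)
  show "(\<lambda>x::'a. x /\<^sub>R norm x) \<in> borel_measurable (restrict_space lborel (cball 0 1 - {0}))"
    by (intro measurable_restrict_space1) measurable
qed

lemma emeasure_sphere_measure:
  fixes A :: "'a::euclidean_space set"
  assumes "A \<in> sets borel" "A \<subseteq> sphere 0 1"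
  shows "emeasure sphere_measure A =
           ennreal (real DIM('a)) * emeasure lborel {r *\<^sub>R v | r v. v \<in> A \<and> 0 < r \<and> r \<le> 1}"
proof -
  let ?R = "restrict_space lborel (cball 0 1 - {0}) :: 'a measure"
  have A: "A \<in> sets (restrict_space borel (sphere 0 1))"
    using assms by (auto simp: sets_restrict_space)
  have eq: "(\<lambda>x. x /\<^sub>R norm x) -` A \<inter> space ?R = {r *\<^sub>R v | r v. v \<in> A \<and> 0 < r \<and> r \<le> 1}"
    (is "?L = ?C")
  proof (intro equalityI subsetI)
    fix x assume "x \<in> ?L"
    then show "x \<in> ?C"
      by (auto simp: space_restrict_space intro!: exI[of _ "norm x"] exI[of _ "x /\<^sub>R norm x"])
  next
    fix x assume "x \<in> ?C"
    then obtain r v where "x = r *\<^sub>R v" "v \<in> A" "0 < r" "r \<le> 1" by auto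
    moreover from \<open>v \<in> A\<close> assms have "norm v = 1" by auto
    ultimately show "x \<in> ?L" by (auto simp: space_restrict_space)
  qed
  have "emeasure (distr ?R (restrict_space borel (sphere 0 1)) (\<lambda>x. x /\<^sub>R norm x)) A
      = emeasure ?R ?C"
    using emeasure_distr[OF measurable_radial_projection A] eq by simp
  also have "\<dots> = emeasure lborel ?C"
    using eq by (intro emeasure_restrict_space) (auto simp: space_restrict_space)
  finally show ?thesis by (simp add: sphere_measure_def)
qed

lemma sphere_measure_real: "(sphere_measure :: real measure) = count_space {-1, 1}"
proof (rule measure_eqI_finite[where A = "{-1, 1}"])
  have sp: "sphere 0 1 = {-1, 1 :: real}" by (auto simp: abs_if split: if_splits)
  show "sets (sphere_measure :: real measure) = Pow {-1, 1}"
  proof (intro equalityI subsetI)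
    fix B :: "real set" assume "B \<in> sets sphere_measure"
    then show "B \<in> Pow {-1, 1}"
      using sets.sets_into_space[of B sphere_measure] by (simp add: space_sphere_measure sp)
  next
    fix B :: "real set" assume B: "B \<in> Pow {-1, 1}"
    then have "finite B" by (auto intro: finite_subset)
    then have "B \<in> sets borel" by (intro borel_closed finite_imp_closed)
    with B show "B \<in> sets sphere_measure"
      by (auto simp: sets_sphere_measure sets_restrict_space sp)
  qed
  fix a :: real assume a: "a \<in> {-1, 1}"
  have "{r *\<^sub>R v | r v. v \<in> {1::real} \<and> 0 < r \<and> r \<le> 1} = {0<..1}" by auto
  moreover have "{r *\<^sub>R v | r v. v \<in> {-1::real} \<and> 0 < r \<and> r \<le> 1} = {-1..<0}"
  proof (intro equalityI subsetI)
    fix x :: real assume "x \<in> {-1..<0}"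
    then show "x \<in> {r *\<^sub>R v | r v. v \<in> {-1::real} \<and> 0 < r \<and> r \<le> 1}"
      by (auto intro!: exI[of _ "- x"])
  qed auto
  ultimately have "emeasure lborel {r *\<^sub>R v | r v. v \<in> {a} \<and> 0 < r \<and> r \<le> 1} = 1"
    using a by (auto simp: )
  then show "emeasure sphere_measure {a} = emeasure (count_space {-1, 1}) {a}"
    using a emeasure_sphere_measure[of "{a}"] by (auto simp: sp)
qed auto
text \<open>
  For \<open>\<gamma> < 1\<close> the power \<open>\<bar>x\<bar> powr ((\<gamma> - 1) / 2)\<close> has a pole at \<open>0\<close>, where \<open>powr\<close>
  returns \<open>0\<close>. For each direction this affects the expectations of \<open>\<psi>\<close> below only for
  countably many offsets \<open>b\<close>.
\<close>

definition psi :: "real \<Rightarrow> real \<Rightarrow> real" where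
  "psi \<gamma> x = (if \<gamma> = 1 then (if x \<ge> 0 then 1 else 0) else \<bar>x\<bar> powr ((\<gamma> - 1) / 2))"

definition energy_distance ::
    "real \<Rightarrow> 'a::euclidean_space measure \<Rightarrow> 'a measure \<Rightarrow> real" where
  "energy_distance \<gamma> \<mu> \<nu> =
     sqrt (\<integral>(x, x', y, y').
             2 * norm (x - y) powr \<gamma> - norm (x - x') powr \<gamma> - norm (y - y') powr \<gamma>
           \<partial>(\<mu> \<Otimes>\<^sub>M \<mu> \<Otimes>\<^sub>M \<nu> \<Otimes>\<^sub>M \<nu>))"

definition S_const :: "nat \<Rightarrow> real \<Rightarrow> real" where
  "S_const d \<gamma> =
     (if \<gamma> = 1 then pi powr ((real d - 1) / 2) / Gamma ((real d + 1) / 2)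
      else pi powr (real d / 2 + 1) * Gamma (1 - \<gamma> / 2) /
             (\<gamma> * 2 powr (\<gamma> - 1) * Gamma ((real d + \<gamma>) / 2) *
              (cos (pi * (\<gamma> - 1) / 4))\<^sup>2 * (Gamma ((1 - \<gamma>) / 2))\<^sup>2))"

end

theory Submission
  imports Defs "HOL-Real_Asymp.Real_Asymp"
begin

text \<open>
  For real \<open>x, y\<close> the function \<open>b \<mapsto> \<psi>(x - b) - \<psi>(y - b)\<close> lies in \<open>L\<^sup>2\<close>, and by scaling its
  squared norm is \<open>C \<bar>x - y\<bar> powr \<gamma>\<close>; the constant \<open>C\<close> reduces to Beta integrals.
  Averaging over directions replaces \<open>\<bar>\<langle>x - y, v\<rangle>\<bar>\<close> by \<open>\<parallel>x - y\<parallel>\<close> up to a factor, which is found by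
  comparing a Gaussian integral in polar coordinates with the fact that a linear form of a
  standard Gaussian vector is normally distributed. Hence, with \<open>l = (v, b)\<close> and
  \<open>g x l = \<psi>(\<langle>x, v\<rangle> - b)\<close>, the squared \<open>L\<^sup>2\<close> distance of \<open>g x\<close> and \<open>g y\<close> is \<open>2 S \<parallel>x - y\<parallel> powr \<gamma>\<close>.
  Only differences of values of \<open>g\<close> are square integrable, so the square of the mean of
  \<open>g X - g Y\<close> is written as a double integral over independent copies of \<open>(X, Y)\<close>; Fubini and
  the polarization identity
  \<open>2 (a - b)(c - d) = (a - d)\<^sup>2 + (b - c)\<^sup>2 - (a - c)\<^sup>2 - (b - d)\<^sup>2\<close>
  turn it into the energy distance.
\<close>

section \<open>Increments of powers on the line\<close>

text \<open>The obstacle on the line is that the square cannot be expanded globally: with s =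
  (\<gamma> - 1) / 2 in (-1/2, 1/2), each of t^(2s) and t^s (1 + t)^s has a divergent integral at
  infinity. The line is therefore cut at the two poles. Between them the terms are separately
  integrable; on the tails, which are mirror images, an antiderivative is used whose remainder is a
  convergent Beta integrand. This leaves Gamma (1 - 2s) / Gamma (1 - s), which the reflection
  formula at s and at 2s trades for 1 / cos (pi s).

  The means of \<open>psi\<close> need not exist for every (v, b), and a Bochner integral is then 0.
  Finite \<gamma>-th moments bound the second moment of g X - g Y integrated over l, so for almost
  every l the difference is integrable, and then so is each term.

  The energy is not assumed nonnegative: the same use of Fubini identifies it, up to a positive
  factor, with an integral of squares. The closed form of S equals half the product of the line
  constant and the sphere factor, by reflection and duplication of Gamma; the half comes from
  polarization.\<close>

text \<open>The substitution \<open>t = u / (1 - u)\<close> carries (0, 1) onto the half line, with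
  \<open>1 + t = 1 / (1 - u)\<close> and Jacobian \<open>1 / (1 - u)\<^sup>2\<close>, and produces
  Euler's Beta integrand. Nonnegativity delivers integrability together with the value.\<close>

lemma Beta_half_line:
  fixes a b :: real
  assumes ab: "0 < a" "0 < b"
  shows "set_integrable lborel {0<..} (\<lambda>t. t powr (a - 1) * (1 + t) powr (- a - b))"
    and "(LBINT t:{0<..}. t powr (a - 1) * (1 + t) powr (- a - b)) = Beta a b"
proof -
  let ?f = "\<lambda>t::real. t powr (a - 1) * (1 + t) powr (- a - b)"
  let ?h = "\<lambda>u::real. u powr (a - 1) * (1 - u) powr (b - 1)"
  have eq: "?f (u / (1 - u)) * (1 / (1 - u)\<^sup>2) = ?h u" if u: "0 < u" "u < 1" for u
  proof -
    have "1 + u / (1 - u) = 1 / (1 - u)" using u by (simp add: field_simps)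
    moreover have "(1 - u) powr (b - 1) = (1 - u) powr (- (a - 1)) * (1 - u) powr (a + b) * (1 - u) powr (- 2)"
      using u by (simp flip: powr_add)
    moreover have "(1 - u) powr (- 2) = 1 / (1 - u)\<^sup>2"
      using u by (simp add: powr_minus_divide)
    moreover have "(1 / (1 - u)) powr (- a - b) = (1 - u) powr (a + b)"
      using u by (simp add: powr_divide powr_minus_divide powr_diff powr_add field_simps)
    moreover have "(u / (1 - u)) powr (a - 1) = u powr (a - 1) * (1 - u) powr (- (a - 1))"
      using u by (simp add: powr_divide powr_diff powr_minus_divide)
    ultimately show ?thesis by simp
  qed
  have int: "set_integrable lborel (einterval 0 1) ?h"
    by (rule set_integrable_subset[OF integrable_Beta[OF ab]]) (auto simp: einterval_def)
  have int': "set_integrable lborel (einterval 0 1) (\<lambda>u. ?f (u / (1 - u)) * (1 / (1 - u)\<^sup>2))"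
    using int by (subst set_integrable_cong[OF refl refl eq]) (auto simp: einterval_def)
  have d: "DERIV (\<lambda>u. u / (1 - u)) x :> 1 / (1 - x)\<^sup>2" if "0 < ereal x" "ereal x < 1" for x
    using that by (auto intro!: derivative_eq_intros simp: power2_eq_square)
  have A: "((ereal \<circ> (\<lambda>u. u / (1 - u)) \<circ> real_of_ereal) \<longlongrightarrow> 0) (at_right (0::ereal))"
    unfolding zero_ereal_def ereal_tendsto_simps by real_asymp
  have B: "((ereal \<circ> (\<lambda>u. u / (1 - u)) \<circ> real_of_ereal) \<longlongrightarrow> \<infinity>) (at_left (1::ereal))"
    unfolding one_ereal_def ereal_tendsto_simps by real_asymp
  have sub: "set_integrable lborel (einterval 0 \<infinity>) ?f"
       "(LBINT x=0..\<infinity>. ?f x) = (LBINT u=0..1. ?f (u / (1 - u)) * (1 / (1 - u)\<^sup>2))"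
    by (rule interval_integral_substitution_nonneg[of 0 1 "\<lambda>u. u / (1 - u)" "\<lambda>u. 1 / (1 - u)\<^sup>2" ?f, OF _ d _ _ _ _ A B int'];
        auto intro!: continuous_intros simp: add_nonneg_eq_0_iff)+
  show "set_integrable lborel {0<..} ?f"
    using sub(1) by (simp add: einterval_def greaterThan_def)
  have "(LBINT t:{0<..}. ?f t) = (LBINT u=0..1. ?f (u / (1 - u)) * (1 / (1 - u)\<^sup>2))"
    using sub(2) by (simp add: interval_lebesgue_integral_0_infty)
  also have "\<dots> = (LBINT u=0..1. ?h u)"
    by (rule interval_integral_cong, rule eq) (auto simp: einterval_def)
  also have "\<dots> = (LBINT u:{0..1}. ?h u)"
    by (simp add: zero_ereal_def one_ereal_def interval_integral_Icc)
  also have "\<dots> = integral {0..1} ?h"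
    by (rule set_borel_integral_eq_integral(2)[OF integrable_Beta[OF ab]])
  also have "\<dots> = Beta a b"
    using has_integral_Beta_real[OF ab] by (rule integral_unique)
  finally show "(LBINT t:{0<..}. ?f t) = Beta a b" .
qed

lemma Gamma_plus1_pos:
  fixes x :: real
  assumes "0 < x"
  shows "Gamma (x + 1) = x * Gamma x"
  using assms by (intro Gamma_plus1) (auto dest: nonpos_Ints_nonpos)

text \<open>No condition on \<open>z\<close> is required: at an integer one of the two factors is at
  a pole, where \<open>Gamma\<close> is 0, and the right side is a division by 0.\<close>

lemma Gamma_reflection_real:
  fixes z :: real
  shows "Gamma z * Gamma (1 - z) = pi / sin (pi * z)"
proof -
  have "complex_of_real (Gamma z * Gamma (1 - z)) = Gamma (of_real z) * Gamma (1 - of_real z)"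
    by (simp flip: Gamma_complex_of_real)
  also have "\<dots> = of_real (pi / sin (pi * z))"
    by (simp add: Gamma_reflection_complex sin_of_real flip: of_real_mult)
  finally have "complex_of_real (Gamma z * Gamma (1 - z)) = of_real (pi / sin (pi * z))" .
  then show ?thesis by (simp only: of_real_eq_iff)
qed

text \<open>Here \<open>F\<close> is an antiderivative of \<open>f\<close> up to a remainder \<open>p\<close> whose integral is known.\<close>

lemma integral_half_line_FTC:
  fixes f p F :: "real \<Rightarrow> real"
  assumes F: "\<And>x. 0 < x \<Longrightarrow> DERIV F x :> f x - p x"
    and f: "\<And>x. 0 < x \<Longrightarrow> isCont f x" and p: "\<And>x. 0 < x \<Longrightarrow> isCont p x"
    and nn: "\<And>x. 0 < x \<Longrightarrow> 0 \<le> f x"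
    and intp: "set_integrable lborel {0<..} p"
    and A: "(F \<longlongrightarrow> A) (at_right 0)" and B: "(F \<longlongrightarrow> B) at_top"
  shows "set_integrable lborel {0<..} f"
    and "(LBINT t:{0<..}. f t) = B - A + (LBINT t:{0<..}. p t)"
proof -
  have ei: "einterval 0 \<infinity> = {0<..}" by (auto simp: einterval_def)
  \<comment> \<open>Compact intervals exhausting the half line, since nothing is known at 0. The
    integrals of \<open>f\<close> over them converge; as \<open>f\<close> is nonnegative, this
    yields integrability as well as the value.\<close>
  obtain u l :: "nat \<Rightarrow> real" where approx:
    "einterval 0 \<infinity> = (\<Union>i. {l i .. u i})"
    "incseq u" "decseq l" "\<And>i. l i < u i" "\<And>i. 0 < ereal (l i)" "\<And>i. ereal (u i) < \<infinity>"
    "l \<longlonglongrightarrow> (0::ereal)" "u \<longlonglongrightarrow> (\<infinity>::ereal)"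
    by (rule einterval_Icc_approximation[of 0 \<infinity>]) auto
  have l0: "0 < l i" for i using approx(5)[of i] by simp
  have cf: "continuous_on {l i..u i} f" and cp: "continuous_on {l i..u i} p" for i
    using l0[of i] by (auto intro!: continuous_at_imp_continuous_on f p)
  have 1: "set_integrable lborel {l i..u i} f" for i
    by (intro borel_integrable_atLeastAtMost' cf)
  have 2: "set_borel_measurable lborel (einterval 0 \<infinity>) f"
    unfolding set_borel_measurable_def
    by (auto simp del: real_scaleR_def intro!: borel_measurable_continuous_on_indicator
             simp: continuous_on_eq_continuous_at einterval_iff f)
  have FTC: "(LBINT x=l i..u i. f x) = F (u i) - F (l i) + (LBINT x=l i..u i. p x)" for i
  proof -
    have "(LBINT x=l i..u i. f x - p x) = F (u i) - F (l i)"
      using approx(4)[of i] l0[of i]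
      by (intro interval_integral_FTC_finite)
         (auto intro!: continuous_intros cf cp has_field_derivative_at_within[OF F] simp flip: has_real_derivative_iff_has_vector_derivative)
    moreover have "(LBINT x=l i..u i. f x - p x) = (LBINT x=l i..u i. f x) - (LBINT x=l i..u i. p x)"
      using approx(4)[of i] l0[of i]
      by (intro interval_lebesgue_integral_diff interval_integrable_isCont f p) auto
    ultimately show ?thesis by simp
  qed
  have lim_l: "(\<lambda>i. F (l i)) \<longlonglongrightarrow> A"
    using A approx(7) l0 unfolding tendsto_at_iff_sequentially comp_def zero_ereal_def by auto
  have lim_u: "(\<lambda>i. F (u i)) \<longlonglongrightarrow> B"
    using filterlim_compose[OF B] approx(8) by (simp add: tendsto_PInfty_eq_at_top)
  have lim_p: "(\<lambda>i. LBINT x=l i..u i. p x) \<longlonglongrightarrow> (LBINT x=0..\<infinity>. p x)"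
    by (rule interval_integral_Icc_approx_integrable[OF _ approx]) (auto simp: ei intp)
  have lim: "(\<lambda>i. LBINT x=l i..u i. f x) \<longlonglongrightarrow> B - A + (LBINT x=0..\<infinity>. p x)"
    unfolding FTC by (intro tendsto_intros lim_l lim_u lim_p)
  note res = interval_integral_Icc_approx_nonneg[OF _ approx 1 _ 2 lim]
  show "set_integrable lborel {0<..} f"
    using res(1) nn by (simp add: ei)
  show "(LBINT t:{0<..}. f t) = B - A + (LBINT t:{0<..}. p t)"
    using res(2) nn by (simp add: interval_lebesgue_integral_0_infty)
qed

text \<open>\<open>?F\<close> comes from integrating the cross term by parts: (s + b + 1) t^s (1 +
  t)^b is the derivative of t^(s+1) (1 + t)^b plus b t^s (1 + t)^(b-1). Used for b = s and b = s -
  1, this leaves a multiple of t^s (1 + t)^(s-2), integrable at infinity because s < 1/2. The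
  division by 2s in the second use cancels, so s = 0 is no exception.\<close>

lemma integral_powr_increment_half_line:
  fixes s :: real
  assumes s: "- 1/2 < s" "s < 1/2"
  shows "set_integrable lborel {0<..} (\<lambda>t. ((1 + t) powr s - t powr s)\<^sup>2)"
    and "(LBINT t:{0<..}. ((1 + t) powr s - t powr s)\<^sup>2)
         = (Gamma (s + 1) * Gamma (1 - 2 * s) / Gamma (1 - s) - 1) / (2 * s + 1)"
proof -
  let ?f = "\<lambda>t. ((1 + t) powr s - t powr s)\<^sup>2"
  let ?q = "\<lambda>t. t powr ((s + 1) - 1) * (1 + t) powr (- (s + 1) - (1 - 2 * s))"
  let ?p = "\<lambda>t. ((1 - s) / (2 * s + 1)) * ?q t"
  let ?F = "\<lambda>t. ((1 + t) powr (2 * s + 1) + t powr (2 * s + 1)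
      - 2 * t powr (s + 1) * (1 + t) powr s - t powr (s + 1) * (1 + t) powr (s - 1)) / (2 * s + 1)"
  have q: "set_integrable lborel {0<..} ?q" "(LBINT t:{0<..}. ?q t) = Beta (s + 1) (1 - 2 * s)"
    by (rule Beta_half_line; use s in simp)+
  have p: "set_integrable lborel {0<..} ?p"
    "(LBINT t:{0<..}. ?p t) = ((1 - s) / (2 * s + 1)) * Beta (s + 1) (1 - 2 * s)"
    using q by simp_all
  have D: "DERIV ?F t :> ?f t - ?p t" if t: "0 < t" for t
  proof -
    \<comment> \<open>Every power that occurs is \<open>x\<close> or \<open>y\<close>, or a product
      of these, times a rational function of \<open>t\<close>; the derivative identity becomes
      rational algebra.\<close>
    define x where "x = t powr s"
    define y where "y = (1 + t) powr s"
    have e: "(1 + t) powr (2 * s) = y\<^sup>2" "t powr (2 * s) = x\<^sup>2"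
      "t powr (s + 1) = t * x" "(1 + t) powr (s - 1) = y / (1 + t)"
      "(1 + t) powr (s - 1 - 1) = y / (1 + t)\<^sup>2" "(1 + t) powr (- (s + 1) - (1 - 2 * s)) = y / (1 + t)\<^sup>2"
      "(1 + t) powr (s - 2) = y / (1 + t)\<^sup>2" "t powr s = x" "(1 + t) powr s = y"
      using t by (simp_all add: x_def y_def powr_add powr_diff powr_mult_base power2_eq_square flip: powr_add)
        (simp_all add: powr_diff powr_add powr_minus field_simps power2_eq_square)
    show ?thesis
      using t s
      apply (auto intro!: derivative_eq_intros simp: e)
      apply (simp add: divide_simps power2_eq_square)
      apply (simp add: algebra_simps)
      done
  qed
  have A: "(?F \<longlongrightarrow> 1 / (2 * s + 1)) (at_right 0)"
    unfolding inverse_eq_divide[symmetric] using s by real_asymp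
  have B: "(?F \<longlongrightarrow> 0) at_top"
  proof -
    \<comment> \<open>The leading terms of \<open>?F\<close> grow like t^(2s+1) and cancel.
      Regrouped by the increment (1 + t)^s - t^s, which is of order s t^(s-1), they form three terms
      of order at most t^(2s-1), which tends to 0. The increment vanishes for s = 0, hence the case
      distinction.\<close>
    have l1: "((\<lambda>t. t * ((1 + t) powr s - t powr s)\<^sup>2) \<longlongrightarrow> 0) at_top"
    proof (cases s "0::real" rule: linorder_cases)
      case less
      with s show ?thesis by real_asymp
    next
      case equal
      then show ?thesis by (intro tendsto_eventually eventually_mono[OF eventually_gt_at_top[of 0]]) simp
    next
      case greater
      with s show ?thesis by real_asymp
    qed
    have l2: "((\<lambda>t. (1 + t) powr s * ((1 + t) powr s - t powr s)) \<longlongrightarrow> 0) at_top"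
    proof (cases s "0::real" rule: linorder_cases)
      case less
      with s show ?thesis by real_asymp
    next
      case equal
      then show ?thesis by (intro tendsto_eventually eventually_mono[OF eventually_gt_at_top[of 0]]) simp
    next
      case greater
      with s show ?thesis by real_asymp
    qed
    have l3: "((\<lambda>t. t powr s * (1 + t) powr s / (1 + t)) \<longlongrightarrow> 0) at_top"
      using s by real_asymp
    have lim: "((\<lambda>t. (t * ((1 + t) powr s - t powr s)\<^sup>2 + (1 + t) powr s * ((1 + t) powr s - t powr s)
        + t powr s * (1 + t) powr s / (1 + t)) / (2 * s + 1)) \<longlongrightarrow> (0 + 0 + 0) / (2 * s + 1)) at_top"
      using s by (intro tendsto_intros l1 l2 l3) auto
    have "\<forall>\<^sub>F t in at_top. (t * ((1 + t) powr s - t powr s)\<^sup>2 + (1 + t) powr s * ((1 + t) powr s - t powr s)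
        + t powr s * (1 + t) powr s / (1 + t)) / (2 * s + 1) = ?F t"
      using eventually_gt_at_top[of 0]
    proof eventually_elim
      case (elim t)
      have double: "x powr (2 * s + 1) = (x powr s)\<^sup>2 * x" if "0 < x" for x :: real
      proof -
        have "x powr (2 * s) = (x powr s)\<^sup>2"
          using that by (simp add: power2_eq_square flip: powr_add)
        then show ?thesis using that by (simp add: powr_add)
      qed
      have "(1 + t) powr (2 * s + 1) = ((1 + t) powr s)\<^sup>2 * (1 + t)"
        "t powr (2 * s + 1) = (t powr s)\<^sup>2 * t"
        using elim by (simp_all add: double)
      moreover have "t powr (s + 1) = t powr s * t" "(1 + t) powr (s - 1) = (1 + t) powr s / (1 + t)"
        using elim by (simp_all add: powr_add powr_diff)
      moreover have "t * (y - x)\<^sup>2 + y * (y - x) + x * y / (1 + t)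
          = y\<^sup>2 * (1 + t) + x\<^sup>2 * t - 2 * (x * t) * y - x * t * (y / (1 + t))" for x y :: real
        using elim by (simp add: divide_simps) (simp add: power2_eq_square algebra_simps)
      ultimately show ?case by presburger
    qed
    from Lim_transform_eventually[OF lim this] show ?thesis by simp
  qed
  have s1: "2 * s + 1 \<noteq> 0" using s by linarith
  note res = integral_half_line_FTC[OF D _ _ _ p(1) A B]
  show "set_integrable lborel {0<..} ?f"
    by (rule res(1)) (auto intro!: continuous_intros simp: s1)
  have "(LBINT t:{0<..}. ?f t) = 0 - 1 / (2 * s + 1) + (LBINT t:{0<..}. ?p t)"
    by (rule res(2)) (auto intro!: continuous_intros simp: s1)
  also have "(LBINT t:{0<..}. ?p t) = ((1 - s) / (2 * s + 1)) * Beta (s + 1) (1 - 2 * s)" by (rule p)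
  also have "Beta (s + 1) (1 - 2 * s) = Gamma (s + 1) * Gamma (1 - 2 * s) / ((1 - s) * Gamma (1 - s))"
  proof -
    have "s + 1 + (1 - 2 * s) = 1 - s + 1" by simp
    moreover have "Gamma (1 - s + 1) = (1 - s) * Gamma (1 - s)"
      using s by (intro Gamma_plus1_pos) simp
    ultimately show ?thesis by (simp only: Beta_def)
  qed
  also have "0 - 1 / (2 * s + 1) + (1 - s) / (2 * s + 1) * (Gamma (s + 1) * Gamma (1 - 2 * s) / ((1 - s) * Gamma (1 - s)))
         = (Gamma (s + 1) * Gamma (1 - 2 * s) / Gamma (1 - s) - 1) / (2 * s + 1)"
  proof -
    have "0 - 1 / m + (1 - s) / m * (G / ((1 - s) * H)) = (G / H - 1) / m" if "m \<noteq> 0" for m G H :: real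
    proof -
      have "(1 - s) / m * (G / ((1 - s) * H)) = ((1 - s) / (1 - s)) * (G / H) / m" by simp
      also have "\<dots> = G / H / m" using s by simp
      finally show ?thesis by (simp only: diff_divide_distrib)
    qed
    from this[OF s1] show ?thesis .
  qed
  finally show "(LBINT t:{0<..}. ?f t)
         = (Gamma (s + 1) * Gamma (1 - 2 * s) / Gamma (1 - s) - 1) / (2 * s + 1)" .
qed

text \<open>Between the poles all three terms of the expanded square are integrable, each being a
  Beta integral: the pure squares with parameters 2s + 1 and 1, the cross term with s + 1 twice. The
  inequality records that the value is nonnegative, so \<open>ennreal\<close> does not truncate
  it.\<close>

lemma nn_integral_powr_diff_unit_interval:
  fixes s :: real
  assumes s: "- 1/2 < s" "s < 1/2"
  shows "(\<integral>\<^sup>+u. ennreal ((\<bar>u\<bar> powr s - \<bar>1 - u\<bar> powr s)\<^sup>2) * indicator {0..1} u \<partial>lborel)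
         = ennreal (2 / (2 * s + 1) - 2 * Beta (s + 1) (s + 1))"
    and "2 * Beta (s + 1) (s + 1) \<le> 2 / (2 * s + 1)"
proof -
  have 1: "((\<lambda>u. u powr (2 * s)) has_integral 1 / (2 * s + 1)) {0<..<1}"
  proof -
    have "((\<lambda>t. t powr (2 * s + 1 - 1) * (1 - t) powr (1 - 1)) has_integral Beta (2 * s + 1) 1) {0<..<1}"
      using has_integral_Beta_real[of "2 * s + 1" 1] s by (simp add: has_integral_Icc_iff_Ioo)
    moreover have "Beta (2 * s + 1) 1 = 1 / (2 * s + 1)"
      using Gamma_plus1_pos[of "2 * s + 1"] Gamma_real_pos[of "2 * s + 1"] s
      by (simp add: Beta_def add.commute less_imp_neq[symmetric])
    ultimately show ?thesis
      by (subst has_integral_cong[where g = "\<lambda>t. t powr (2 * s + 1 - 1) * (1 - t) powr (1 - 1)"]) auto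
  qed
  have 2: "((\<lambda>u. (1 - u) powr (2 * s)) has_integral 1 / (2 * s + 1)) {0<..<1}"
  proof -
    have "((\<lambda>t. t powr (1 - 1) * (1 - t) powr (2 * s + 1 - 1)) has_integral Beta 1 (2 * s + 1)) {0<..<1}"
      using has_integral_Beta_real[of 1 "2 * s + 1"] s by (simp add: has_integral_Icc_iff_Ioo)
    moreover have "Beta 1 (2 * s + 1) = 1 / (2 * s + 1)"
      using Gamma_plus1_pos[of "2 * s + 1"] Gamma_real_pos[of "2 * s + 1"] s
      by (simp add: Beta_def add.commute less_imp_neq[symmetric])
    ultimately show ?thesis
      by (subst has_integral_cong[where g = "\<lambda>t. t powr (1 - 1) * (1 - t) powr (2 * s + 1 - 1)"]) auto
  qed
  have 3: "((\<lambda>u. u powr s * (1 - u) powr s) has_integral Beta (s + 1) (s + 1)) {0<..<1}"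
    using has_integral_Beta_real[of "s + 1" "s + 1"] s by (simp add: has_integral_Icc_iff_Ioo)
  have "((\<lambda>u. u powr (2 * s) + (1 - u) powr (2 * s) - 2 * (u powr s * (1 - u) powr s))
      has_integral 1 / (2 * s + 1) + 1 / (2 * s + 1) - 2 * Beta (s + 1) (s + 1)) {0<..<1}"
    by (intro has_integral_add has_integral_diff has_integral_mult_right 1 2 3)
  then have "((\<lambda>u. (\<bar>u\<bar> powr s - \<bar>1 - u\<bar> powr s)\<^sup>2)
      has_integral 1 / (2 * s + 1) + 1 / (2 * s + 1) - 2 * Beta (s + 1) (s + 1)) {0<..<1}"
    by (subst has_integral_cong[where g = "\<lambda>u. u powr (2 * s) + (1 - u) powr (2 * s) - 2 * (u powr s * (1 - u) powr s)"])
       (auto simp: power2_eq_square algebra_simps simp flip: powr_add)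
  then have I: "((\<lambda>u. (\<bar>u\<bar> powr s - \<bar>1 - u\<bar> powr s)\<^sup>2)
      has_integral 2 / (2 * s + 1) - 2 * Beta (s + 1) (s + 1)) {0..1}"
    by (simp add: has_integral_Icc_iff_Ioo add_divide_distrib[symmetric])
  then show "(\<integral>\<^sup>+u. ennreal ((\<bar>u\<bar> powr s - \<bar>1 - u\<bar> powr s)\<^sup>2) * indicator {0..1} u \<partial>lborel)
         = ennreal (2 / (2 * s + 1) - 2 * Beta (s + 1) (s + 1))"
    by (rule nn_integral_has_integral_lebesgue'[rotated]) simp
  show "2 * Beta (s + 1) (s + 1) \<le> 2 / (2 * s + 1)"
    using has_integral_nonneg[OF I] by simp
qed

text \<open>The integrand is invariant under u -> 1 - u, which exchanges the tails; u = 1 + t and u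
  = - t reduce both to the half-line increment.\<close>

lemma nn_integral_powr_diff_outside:
  fixes s :: real
  assumes s: "- 1/2 < s" "s < 1/2"
  defines "K \<equiv> (Gamma (s + 1) * Gamma (1 - 2 * s) / Gamma (1 - s) - 1) / (2 * s + 1)"
  shows "(\<integral>\<^sup>+u. ennreal ((\<bar>u\<bar> powr s - \<bar>1 - u\<bar> powr s)\<^sup>2) * indicator {1<..} u \<partial>lborel) = ennreal K"
    and "(\<integral>\<^sup>+u. ennreal ((\<bar>u\<bar> powr s - \<bar>1 - u\<bar> powr s)\<^sup>2) * indicator {..<0} u \<partial>lborel) = ennreal K"
    and "0 \<le> K"
proof -
  let ?f = "\<lambda>t. ((1 + t) powr s - t powr s)\<^sup>2"
  note K = integral_powr_increment_half_line[OF s, folded K_def]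
  have *: "(\<integral>\<^sup>+t. ennreal (?f t) * indicator {0<..} t \<partial>lborel) = ennreal K"
  proof -
    have "(\<integral>\<^sup>+t. ennreal (indicator {0<..} t *\<^sub>R ?f t) \<partial>lborel) = ennreal (LBINT t:{0<..}. ?f t)"
      unfolding set_lebesgue_integral_def
      using K(1) by (intro nn_integral_eq_integral) (auto simp: set_integrable_def)
    also have "(\<lambda>t. ennreal (indicator {0<..} t *\<^sub>R ?f t)) = (\<lambda>t. ennreal (?f t) * indicator {0<..} t)"
      by (auto simp: indicator_def)
    finally show ?thesis unfolding K(2) .
  qed
  show "0 \<le> K"
    unfolding K(2)[symmetric] set_lebesgue_integral_def by (intro integral_nonneg_AE) auto
  show "(\<integral>\<^sup>+u. ennreal ((\<bar>u\<bar> powr s - \<bar>1 - u\<bar> powr s)\<^sup>2) * indicator {1<..} u \<partial>lborel) = ennreal K"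
    by (subst nn_integral_real_affine[where c = 1 and t = 1])
       (auto simp: *[symmetric] indicator_def intro!: nn_integral_cong)
  show "(\<integral>\<^sup>+u. ennreal ((\<bar>u\<bar> powr s - \<bar>1 - u\<bar> powr s)\<^sup>2) * indicator {..<0} u \<partial>lborel) = ennreal K"
    by (subst nn_integral_real_affine[where c = "- 1" and t = 0])
       (auto simp: *[symmetric] indicator_def power2_commute intro!: nn_integral_cong)
qed

lemma nn_integral_split_unit_interval:
  fixes f :: "real \<Rightarrow> ennreal"
  assumes [measurable]: "f \<in> borel_measurable borel"
  shows "(\<integral>\<^sup>+u. f u \<partial>lborel) = (\<integral>\<^sup>+u. f u * indicator {0..1} u \<partial>lborel)
      + ((\<integral>\<^sup>+u. f u * indicator {1<..} u \<partial>lborel) + (\<integral>\<^sup>+u. f u * indicator {..<0} u \<partial>lborel))"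
proof -
  have "(\<integral>\<^sup>+u. f u \<partial>lborel)
      = (\<integral>\<^sup>+u. f u * indicator {0..1} u + (f u * indicator {1<..} u + f u * indicator {..<0} u) \<partial>lborel)"
    by (intro nn_integral_cong) (auto simp: indicator_def)
  then show ?thesis by (simp add: nn_integral_add)
qed

lemma nn_integral_powr_diff:
  fixes s :: real
  assumes s: "- 1/2 < s" "s < 1/2"
  shows "(\<integral>\<^sup>+u. ennreal ((\<bar>u\<bar> powr s - \<bar>1 - u\<bar> powr s)\<^sup>2) \<partial>lborel)
         = ennreal (2 * (1 / cos (pi * s) - 1) * (Gamma (s + 1))\<^sup>2 / Gamma (2 * s + 2))"
proof -
  let ?f = "\<lambda>u::real. ennreal ((\<bar>u\<bar> powr s - \<bar>1 - u\<bar> powr s)\<^sup>2)"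
  define K where "K = (Gamma (s + 1) * Gamma (1 - 2 * s) / Gamma (1 - s) - 1) / (2 * s + 1)"
  note out = nn_integral_powr_diff_outside[OF s, folded K_def]
  define L where "L = 2 / (2 * s + 1) - 2 * Beta (s + 1) (s + 1)"
  note inn = nn_integral_powr_diff_unit_interval[OF s, folded L_def]
  have L: "0 \<le> L"
    using inn(2) by (simp add: L_def)
  have m: "?f \<in> borel_measurable borel" by measurable
  have "(\<integral>\<^sup>+u. ?f u \<partial>lborel) = (\<integral>\<^sup>+u. ?f u * indicator {0..1} u \<partial>lborel)
      + ((\<integral>\<^sup>+u. ?f u * indicator {1<..} u \<partial>lborel) + (\<integral>\<^sup>+u. ?f u * indicator {..<0} u \<partial>lborel))"
    using nn_integral_split_unit_interval[OF m] .
  also have "\<dots> = ennreal L + (ennreal K + ennreal K)"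
    unfolding inn(1) out(1,2) ..
  also have "\<dots> = ennreal (L + 2 * K)"
    using L out(3) by (simp flip: ennreal_plus)
  \<comment> \<open>The rational parts 2 / (2s + 1) of \<open>L\<close> and \<open>2 * K\<close>
    cancel; what remains is to rewrite Gamma (1 - 2s) / Gamma (1 - s) in \<open>K\<close>.\<close>
  also have "L + 2 * K = 2 * (1 / cos (pi * s) - 1) * (Gamma (s + 1))\<^sup>2 / Gamma (2 * s + 2)"
  proof (cases "s = 0")
    case True
    then show ?thesis by (simp add: L_def K_def Beta_def Gamma_numeral)
  next
    case False
    have "pi * (- 1 / 2) < pi * s" "pi * s < pi * (1 / 2)"
      using s by (intro mult_strict_left_mono pi_gt_zero; simp)+
    then have "- (pi / 2) < pi * s" "pi * s < pi / 2"
      by simp_all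
    then have sn: "sin (pi * s) \<noteq> 0" and cs: "0 < cos (pi * s)"
    proof -
      show "0 < cos (pi * s)" by (rule cos_gt_zero_pi) fact+
      have "pi * s \<noteq> 0" using False by simp
      moreover have "- pi < pi * s" "pi * s < pi"
        using \<open>- (pi / 2) < pi * s\<close> \<open>pi * s < pi / 2\<close> pi_gt_zero by linarith+
      ultimately show "sin (pi * s) \<noteq> 0"
        using sin_eq_0_pi[of "pi * s"] by metis
    qed
    have g1: "0 < Gamma (s + 1)" "0 < Gamma (1 - s)" "0 < Gamma (1 - 2 * s)" "0 < Gamma (2 * s + 1)"
      by (rule Gamma_real_pos; use s in simp)+
    have g3: "Gamma (s + 1) = s * Gamma s" "Gamma (2 * s + 1) = 2 * s * Gamma (2 * s)"
    proof -
      have "z \<notin> \<int>\<^sub>\<le>\<^sub>0" if "z \<noteq> 0" "- 1 < z" for z :: real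
      proof
        assume "z \<in> \<int>\<^sub>\<le>\<^sub>0"
        then obtain n where n: "z = of_int n" "n \<le> 0" by (rule nonpos_Ints_cases)
        with that have "n = 0" by linarith
        with n that show False by simp
      qed
      then have "s \<notin> \<int>\<^sub>\<le>\<^sub>0" "2 * s \<notin> \<int>\<^sub>\<le>\<^sub>0"
        using False s by simp_all
      then show "Gamma (s + 1) = s * Gamma s" "Gamma (2 * s + 1) = 2 * s * Gamma (2 * s)"
        by (blast intro: Gamma_plus1)+
    qed
    \<comment> \<open>Reflection at s, and in \<open>r2\<close> at 2s with the double angle formula.
      Both products equal \<open>pi * s\<close>; equating them and cancelling the sine gives the
      quotient needed in \<open>K\<close>.\<close>
    have r1: "Gamma (s + 1) * Gamma (1 - s) * sin (pi * s) = pi * s"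
    proof -
      have "Gamma (s + 1) * Gamma (1 - s) * sin (pi * s) = s * (Gamma s * Gamma (1 - s)) * sin (pi * s)"
        unfolding g3(1) by (simp only: mult_ac)
      then show ?thesis using sn by (simp add: Gamma_reflection_real)
    qed
    have r2: "Gamma (2 * s + 1) * Gamma (1 - 2 * s) * (sin (pi * s) * cos (pi * s)) = pi * s"
    proof -
      have "sin (pi * (2 * s)) = 2 * (sin (pi * s) * cos (pi * s))"
        using sin_double[of "pi * s"] by (simp add: mult_ac)
      moreover have "Gamma (2 * s + 1) * Gamma (1 - 2 * s) * (sin (pi * s) * cos (pi * s))
          = 2 * s * (Gamma (2 * s) * Gamma (1 - 2 * s)) * (sin (pi * s) * cos (pi * s))"
        unfolding g3(2) by (simp only: mult_ac)
      ultimately show ?thesis using sn cs by (simp add: Gamma_reflection_real)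
    qed
    have g2: "Gamma (2 * s + 2) = (2 * s + 1) * Gamma (2 * s + 1)"
    proof -
      have "2 * s + 2 = 2 * s + 1 + 1" by simp
      also have "Gamma \<dots> = (2 * s + 1) * Gamma (2 * s + 1)"
        by (rule Gamma_plus1_pos) (use s in simp)
      finally show ?thesis .
    qed
    have "Gamma (1 - 2 * s) / Gamma (1 - s) = Gamma (s + 1) / (Gamma (2 * s + 1) * cos (pi * s))"
    proof -
      have "Gamma (1 - 2 * s) * (Gamma (2 * s + 1) * cos (pi * s)) * sin (pi * s)
          = Gamma (s + 1) * Gamma (1 - s) * sin (pi * s)"
        using trans[OF r2 r1[symmetric]] by (simp only: mult_ac)
      then have "Gamma (1 - 2 * s) * (Gamma (2 * s + 1) * cos (pi * s)) = Gamma (s + 1) * Gamma (1 - s)"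
        using sn by (simp only: mult_cancel_right) auto
      moreover have "Gamma (1 - s) \<noteq> 0" "Gamma (2 * s + 1) * cos (pi * s) \<noteq> 0"
        using cs g1 by simp_all
      ultimately show ?thesis by (metis frac_eq_eq)
    qed
    then have K_eq: "K = (Gamma (s + 1) * (Gamma (s + 1) / (Gamma (2 * s + 1) * cos (pi * s))) - 1) / (2 * s + 1)"
      unfolding K_def times_divide_eq_right[symmetric] by (rule arg_cong)
    have L_eq: "L = 2 / (2 * s + 1) - 2 * (Gamma (s + 1) * Gamma (s + 1) / ((2 * s + 1) * Gamma (2 * s + 1)))"
    proof -
      have "s + 1 + (s + 1) = 2 * s + 2" by simp
      then have "Beta (s + 1) (s + 1) = Gamma (s + 1) * Gamma (s + 1) / ((2 * s + 1) * Gamma (2 * s + 1))"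
        unfolding Beta_def g2[symmetric] by (rule arg_cong)
      then show ?thesis unfolding L_def by (rule arg_cong)
    qed
    have alg: "2 / m - 2 * (G * G / (m * H)) + 2 * ((G * (G / (H * c)) - 1) / m)
        = 2 * (1 / c - 1) * G\<^sup>2 / (m * H)" if "m \<noteq> 0" "H \<noteq> 0" "c \<noteq> 0" for G H c m :: real
      using that by (simp add: field_simps power2_eq_square)
    have "2 * s + 1 \<noteq> 0" "Gamma (2 * s + 1) \<noteq> 0" "cos (pi * s) \<noteq> 0"
      using s g1(4) cs by linarith+
    then show ?thesis
      unfolding K_eq L_eq g2 by (rule alg)
  qed
  finally show ?thesis .
qed

text \<open>The squared norm of the increment of \<open>psi\<close> between points at distance 1.
  The value at \<gamma> = 1 is set apart because the general formula gives 0 there, in keeping with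
  a constant power, whereas \<open>psi 1\<close> is a jump function.\<close>

definition psi_const :: "real \<Rightarrow> real" where
  "psi_const \<gamma> = (if \<gamma> = 1 then 1
     else 2 * (1 / cos (pi * (\<gamma> - 1) / 2) - 1) * (Gamma ((\<gamma> + 1) / 2))\<^sup>2 / Gamma (\<gamma> + 1))"

text \<open>For \<gamma> \<noteq> 1 the substitution \<open>b = x + c * u\<close> with
  \<open>c = y - x\<close> moves the poles to 0 and 1. The integrand contributes |c|^(2s) and the
  Jacobian |c|, together |c|^\<gamma>. For \<gamma> = 1 the integrand is the indicator of the
  interval between \<open>x\<close> and \<open>y\<close>.\<close>

lemma nn_integral_psi_diff:
  fixes x y :: real
  assumes \<gamma>: "0 < \<gamma>" "\<gamma> < 2"
  shows "(\<integral>\<^sup>+b. ennreal ((psi \<gamma> (x - b) - psi \<gamma> (y - b))\<^sup>2) \<partial>lborel) = ennreal (psi_const \<gamma> * \<bar>x - y\<bar> powr \<gamma>)"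
proof (cases "\<gamma> = 1")
  case True
  have "ennreal ((psi 1 (x - b) - psi 1 (y - b))\<^sup>2) = indicator {min x y<..max x y} b" for b
    by (auto simp: psi_def indicator_def)
  then show ?thesis
    by (simp add: True psi_const_def max_def min_def)
next
  case False
  define s where "s = (\<gamma> - 1) / 2"
  have s: "- 1/2 < s" "s < 1/2" "\<gamma> = 2 * s + 1" using \<gamma> by (auto simp: s_def field_simps)
  have C: "psi_const \<gamma> = 2 * (1 / cos (pi * s) - 1) * (Gamma (s + 1))\<^sup>2 / Gamma (2 * s + 2)"
  proof -
    have "\<gamma> + 1 = 2 * s + 2" "(\<gamma> + 1) / 2 = s + 1" "pi * (\<gamma> - 1) / 2 = pi * s"
      unfolding s(3) by (simp_all add: field_simps)
    with False show ?thesis by (simp only: psi_const_def if_False)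
  qed
  have psi: "psi \<gamma> u = \<bar>u\<bar> powr s" for u
    using False by (simp add: psi_def s_def)
  show ?thesis
  proof (cases "x = y")
    case True
    then show ?thesis using \<gamma> by simp
  next
    case False
    define c where "c = y - x"
    have c: "c \<noteq> 0" using False by (simp add: c_def)
    have eq: "(psi \<gamma> (x - (x + c * u)) - psi \<gamma> (y - (x + c * u)))\<^sup>2
        = \<bar>c\<bar> powr (2 * s) * (\<bar>u\<bar> powr s - \<bar>1 - u\<bar> powr s)\<^sup>2" for u
    proof -
      have "\<bar>x - (x + c * u)\<bar> = \<bar>c\<bar> * \<bar>u\<bar>" by (simp add: abs_mult)
      moreover have "\<bar>y - (x + c * u)\<bar> = \<bar>c\<bar> * \<bar>1 - u\<bar>"
        by (simp add: c_def algebra_simps flip: abs_mult)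
      moreover have "\<bar>c\<bar> powr (2 * s) = (\<bar>c\<bar> powr s)\<^sup>2"
        by (simp add: power2_eq_square flip: powr_add)
      ultimately show ?thesis
        by (simp add: psi powr_mult power_mult_distrib flip: right_diff_distrib)
    qed
    have [measurable]: "psi \<gamma> \<in> borel_measurable borel"
      unfolding psi_def by measurable
    have "(\<integral>\<^sup>+b. ennreal ((psi \<gamma> (x - b) - psi \<gamma> (y - b))\<^sup>2) \<partial>lborel)
       = \<bar>c\<bar> * (\<integral>\<^sup>+u. ennreal ((psi \<gamma> (x - (x + c * u)) - psi \<gamma> (y - (x + c * u)))\<^sup>2) \<partial>lborel)"
      using c by (intro nn_integral_real_affine) measurable
    also have "\<dots> = \<bar>c\<bar> * (ennreal (\<bar>c\<bar> powr (2 * s)) * ennreal (psi_const \<gamma>))"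
      unfolding eq by (simp add: ennreal_mult nn_integral_cmult nn_integral_powr_diff[OF s(1,2)] C)
    also have "\<dots> = ennreal (psi_const \<gamma> * \<bar>x - y\<bar> powr \<gamma>)"
    proof -
      have "\<bar>c\<bar> * (\<bar>c\<bar> powr (2 * s) * psi_const \<gamma>) = psi_const \<gamma> * \<bar>x - y\<bar> powr \<gamma>"
        using c by (simp add: s(3) powr_add c_def abs_minus_commute)
      moreover have "ennreal \<bar>c\<bar> * (ennreal (\<bar>c\<bar> powr (2 * s)) * ennreal (psi_const \<gamma>))
          = ennreal (\<bar>c\<bar> * (\<bar>c\<bar> powr (2 * s) * psi_const \<gamma>))"
        by (simp add: ennreal_mult')
      ultimately show ?thesis by (simp only:)
    qed
    finally show ?thesis .
  qed
qed

section \<open>Polar coordinates and Gaussian integrals\<close>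

lemma nn_integral_lborel_scaleR:
  fixes f :: "'a::euclidean_space \<Rightarrow> ennreal"
  assumes [measurable]: "f \<in> borel_measurable borel" and c: "0 < c"
  shows "(\<integral>\<^sup>+y. f y \<partial>lborel) = ennreal (c ^ DIM('a)) * (\<integral>\<^sup>+y. f (c *\<^sub>R y) \<partial>lborel)"
  using c by (subst lborel_affine[of c 0])
    (simp_all add: nn_integral_density nn_integral_distr nn_integral_cmult)

lemma nn_integral_power_Ioo:
  assumes "0 < R" "0 < d"
  shows "(\<integral>\<^sup>+r. ennreal (real d * r ^ (d - 1)) * indicator {0<..<R} r \<partial>lborel) = ennreal (R ^ d)"
proof -
  have "((\<lambda>r. real d * r ^ (d - 1)) has_integral R ^ d - 0 ^ d) {0..R}"
    using assms
    by (intro fundamental_theorem_of_calculus)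
       (auto intro!: derivative_eq_intros simp flip: has_real_derivative_iff_has_vector_derivative)
  then have "((\<lambda>r. real d * r ^ (d - 1)) has_integral R ^ d) {0<..<R}"
    using assms by (simp add: has_integral_Icc_iff_Ioo zero_power)
  then show ?thesis
    by (intro nn_integral_has_integral_lebesgue') auto
qed

text \<open>Scaling by \<open>R\<close> fixes \<open>f\<close> and multiplies volume by
  \<open>R ^ DIM('a)\<close>. The open ball is what a strict bound on the norm produces, the closed
  one is what \<open>sphere_measure\<close> is built on; they differ by a null sphere.\<close>

lemma nn_integral_ball_homogeneous:
  fixes f :: "'a::euclidean_space \<Rightarrow> ennreal"
  assumes [measurable]: "f \<in> borel_measurable borel"
    and hom: "\<And>r x. 0 < r \<Longrightarrow> f (r *\<^sub>R x) = f x" and R: "0 < R"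
  shows "(\<integral>\<^sup>+y. f y * indicator (ball 0 R) y \<partial>lborel)
         = ennreal (R ^ DIM('a)) * (\<integral>\<^sup>+y. f y * indicator (cball 0 1) y \<partial>lborel)"
proof -
  have "(\<integral>\<^sup>+y. f y * indicator (ball 0 R) y \<partial>lborel)
      = ennreal (R ^ DIM('a)) * (\<integral>\<^sup>+y. f (R *\<^sub>R y) * indicator (ball 0 R) (R *\<^sub>R y) \<partial>lborel)"
    using R by (intro nn_integral_lborel_scaleR borel_measurable_times_ennreal borel_measurable_indicator) auto
  also have "(\<lambda>y. f (R *\<^sub>R y) * indicator (ball 0 R) (R *\<^sub>R y)) = (\<lambda>y. f y * indicator (ball 0 1) y)"
    using R by (auto simp: hom indicator_def fun_eq_iff)
  also have "(\<integral>\<^sup>+y. f y * indicator (ball 0 1) y \<partial>lborel) = (\<integral>\<^sup>+y. f y * indicator (cball 0 1) y \<partial>lborel)"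
  proof (rule nn_integral_cong_AE)
    have "sphere (0::'a) 1 \<in> null_sets lborel"
      using negligible_sphere[of "0::'a" 1] by (simp add: negligible_iff_null_sets null_sets_completion_iff)
    then have "AE y in lborel. y \<notin> sphere (0::'a) 1" by (rule AE_not_in)
    then show "AE y in lborel. f y * indicator (ball 0 1) y = f y * indicator (cball 0 1) y"
      by eventually_elim (auto simp: indicator_def)
  qed
  finally show ?thesis .
qed

text \<open>Both sides are integrals of \<open>w\<close> against measures on the half-line, which agree on the
  sets \<open>[0, R)\<close> by scaling. The reflection \<open>r \<mapsto> - r\<close> turns these sets into rays of finite measure.\<close>

lemma nn_integral_polar:
  fixes f :: "'a::euclidean_space \<Rightarrow> ennreal" and w :: "real \<Rightarrow> ennreal"
  assumes f[measurable]: "f \<in> borel_measurable borel" and w[measurable]: "w \<in> borel_measurable borel"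
    and hom: "\<And>r x. 0 < r \<Longrightarrow> f (r *\<^sub>R x) = f x"
    and fin: "(\<integral>\<^sup>+y. f y * indicator (cball 0 1) y \<partial>lborel) < \<infinity>"
  shows "(\<integral>\<^sup>+y. f y * w (norm y) \<partial>lborel)
         = (\<integral>\<^sup>+y. f y * indicator (cball 0 1) y \<partial>lborel)
           * (\<integral>\<^sup>+r. ennreal (real DIM('a) * r ^ (DIM('a) - 1)) * indicator {0<..} r * w r \<partial>lborel)"
proof -
  define G where "G = (\<integral>\<^sup>+y. f y * indicator (cball 0 1) y \<partial>lborel)"
  let ?d = "\<lambda>r::real. ennreal (real DIM('a) * r ^ (DIM('a) - 1)) * indicator {0<..} r"
  let ?M = "distr (density lborel f) borel (\<lambda>y. - norm y)"
  let ?N = "distr (density lborel (\<lambda>r. G * ?d r)) borel uminus"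
  have M: "emeasure ?M {x<..} = (\<integral>\<^sup>+y. f y * indicator (ball 0 (- x)) y \<partial>lborel)" for x
  proof -
    have "(\<lambda>y::'a. - norm y) -` {x<..} = ball 0 (- x)" by auto
    then show ?thesis by (simp add: emeasure_distr emeasure_density)
  qed
  have N: "emeasure ?N {x<..} = G * (\<integral>\<^sup>+r. ennreal (real DIM('a) * r ^ (DIM('a) - 1)) * indicator {0<..<- x} r \<partial>lborel)" for x
  proof -
    have "uminus -` {x<..} = {..<- x}" by auto
    then have "emeasure ?N {x<..} = (\<integral>\<^sup>+r. G * ?d r * indicator {..<- x} r \<partial>lborel)"
      by (simp add: emeasure_distr emeasure_density)
    also have "\<dots> = (\<integral>\<^sup>+r. G * (ennreal (real DIM('a) * r ^ (DIM('a) - 1)) * indicator {0<..<- x} r) \<partial>lborel)"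
      by (intro nn_integral_cong) (auto simp: indicator_def)
    finally show ?thesis by (simp add: nn_integral_cmult)
  qed
  have eq: "emeasure ?M {x<..} = emeasure ?N {x<..} \<and> emeasure ?M {x<..} < \<infinity>" for x
  proof (cases "x < 0")
    case True
    then show ?thesis
      using nn_integral_ball_homogeneous[OF f hom, of "- x"] nn_integral_power_Ioo[of "- x" "DIM('a)"] fin
      unfolding M N G_def[symmetric] by (simp add: mult.commute ennreal_mult_less_top)
  next
    case False
    then have e: "ball (0::'a) (- x) = {}" "{0<..<- x} = {}" by simp_all
    show ?thesis unfolding M N e by simp
  qed
  have "?M = ?N"
  proof (rule measure_eqI_lessThan)
    show "emeasure ?M {x<..} < \<infinity>" "emeasure ?M {x<..} = emeasure ?N {x<..}" for x
      using eq by blast+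
  qed simp_all
  then have "(\<integral>\<^sup>+z. w (- z) \<partial>?M) = (\<integral>\<^sup>+z. w (- z) \<partial>?N)" by simp
  then show ?thesis
    by (simp add: nn_integral_distr nn_integral_density nn_integral_cmult mult.assoc flip: G_def)
qed

text \<open>The substitution r = sqrt (2t) gives Euler's integral for \<open>Gamma\<close> at (a +
  1) / 2. It serves twice: with a = \<gamma> for a normal variable, and with a = \<gamma> + d - 1
  for the radial part of a Gaussian vector.\<close>

lemma nn_integral_gaussian_moment:
  fixes a :: real
  assumes a: "- 1 < a"
  shows "(\<integral>\<^sup>+r. ennreal (r powr a * exp (- r\<^sup>2 / 2)) * indicator {0<..} r \<partial>lborel)
         = ennreal (2 powr ((a - 1) / 2) * Gamma ((a + 1) / 2))"
proof -
  let ?f = "\<lambda>r::real. r powr a * exp (- r\<^sup>2 / 2)"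
  let ?h = "\<lambda>t::real. 2 powr ((a - 1) / 2) * (t powr ((a + 1) / 2 - 1) / exp t)"
  have pos: "0 < (a + 1) / 2" using a by simp
  have eq: "?f (sqrt (2 * t)) * (1 / sqrt (2 * t)) = ?h t" if "0 < t" for t
  proof -
    have "sqrt (2 * t) powr a * (1 / sqrt (2 * t)) = (2 * t) powr (a / 2) * (2 * t) powr (- 1 / 2)"
      using that by (simp add: powr_half_sqrt[symmetric] powr_powr powr_minus_divide)
    also have "\<dots> = (2 * t) powr ((a - 1) / 2)"
      by (simp add: diff_divide_distrib flip: powr_add)
    also have "\<dots> = 2 powr ((a - 1) / 2) * t powr ((a + 1) / 2 - 1)"
      using that by (simp add: powr_mult field_simps)
    finally have "sqrt (2 * t) powr a * (1 / sqrt (2 * t)) = 2 powr ((a - 1) / 2) * t powr ((a + 1) / 2 - 1)" .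
    then show ?thesis using that by (simp add: exp_minus field_simps)
  qed
  have hb: "has_bochner_integral lborel (\<lambda>t. indicator {0..} t *\<^sub>R (t powr ((a + 1) / 2 - 1) / exp t)) (Gamma ((a + 1) / 2))"
    by (rule has_bochner_integral_nn_integral)
       (use Gamma_conv_nn_integral_real[OF pos] Gamma_real_pos[OF pos] in \<open>auto simp: mult.assoc\<close>)
  have int: "set_integrable lborel {0..} (\<lambda>t. t powr ((a + 1) / 2 - 1) / exp t)"
    using hb unfolding set_integrable_def by (rule integrable.intros)
  have val: "(LBINT t:{0..}. t powr ((a + 1) / 2 - 1) / exp t) = Gamma ((a + 1) / 2)"
    using hb unfolding set_lebesgue_integral_def by (rule has_bochner_integral_integral_eq)
  have ei: "einterval 0 \<infinity> = {0<..}" by (auto simp: einterval_def)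
  have inth: "set_integrable lborel (einterval 0 \<infinity>) ?h"
    unfolding ei by (intro set_integrable_mult_right impI set_integrable_subset[OF int]) auto
  have int': "set_integrable lborel (einterval 0 \<infinity>) (\<lambda>t. ?f (sqrt (2 * t)) * (1 / sqrt (2 * t)))"
    by (subst set_integrable_cong[OF refl refl eq]) (use inth in \<open>auto simp: einterval_def\<close>)
  have d: "DERIV (\<lambda>t. sqrt (2 * t)) x :> 1 / sqrt (2 * x)" if "0 < ereal x" "ereal x < \<infinity>" for x
    using that by (auto intro!: derivative_eq_intros simp: field_simps)
  have A: "((ereal \<circ> (\<lambda>t. sqrt (2 * t)) \<circ> real_of_ereal) \<longlongrightarrow> 0) (at_right (0::ereal))"
    unfolding zero_ereal_def ereal_tendsto_simps by (auto intro!: tendsto_eq_intros)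
  have B: "((ereal \<circ> (\<lambda>t. sqrt (2 * t)) \<circ> real_of_ereal) \<longlongrightarrow> \<infinity>) (at_left (\<infinity>::ereal))"
    unfolding ereal_tendsto_simps
    by (intro filterlim_compose[OF sqrt_at_top] filterlim_tendsto_pos_mult_at_top[OF tendsto_const]) (auto simp: filterlim_ident)
  have sub: "set_integrable lborel (einterval 0 \<infinity>) ?f"
       "(LBINT x=0..\<infinity>. ?f x) = (LBINT t=0..\<infinity>. ?f (sqrt (2 * t)) * (1 / sqrt (2 * t)))"
    by (rule interval_integral_substitution_nonneg[of 0 \<infinity> "\<lambda>t. sqrt (2 * t)" "\<lambda>t. 1 / sqrt (2 * t)" ?f, OF _ d _ _ _ _ A B int'];
        auto intro!: continuous_intros)+
  have "(\<integral>\<^sup>+r. ennreal (?f r) * indicator {0<..} r \<partial>lborel) = (\<integral>\<^sup>+r. ennreal (indicator {0<..} r *\<^sub>R ?f r) \<partial>lborel)"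
    by (intro nn_integral_cong) (auto simp: indicator_def)
  also have "\<dots> = ennreal (LBINT x=0..\<infinity>. ?f x)"
    using sub(1) unfolding interval_lebesgue_integral_0_infty set_lebesgue_integral_def ei
    by (intro nn_integral_eq_integral) (auto simp: set_integrable_def)
  also have "(LBINT x=0..\<infinity>. ?f x) = (LBINT t=0..\<infinity>. ?h t)"
    unfolding sub(2) by (rule interval_integral_cong, rule eq) (auto simp: einterval_def)
  also have "\<dots> = 2 powr ((a - 1) / 2) * (LBINT t:{0<..}. t powr ((a + 1) / 2 - 1) / exp t)"
    unfolding interval_lebesgue_integral_0_infty by (rule set_integral_mult_right)
  also have "(LBINT t:{0<..}. t powr ((a + 1) / 2 - 1) / exp t) = (LBINT t:{0..}. t powr ((a + 1) / 2 - 1) / exp t)"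
    by (rule set_integral_cong_set) (auto simp: set_borel_measurable_def intro!: AE_I[of _ _ "{0}"])
  finally show ?thesis
    unfolding val .
qed

lemma nn_integral_abs_normal_moment:
  assumes \<gamma>: "- 1 < \<gamma>" and \<sigma>: "0 < \<sigma>"
  shows "(\<integral>\<^sup>+t. ennreal (\<bar>t\<bar> powr \<gamma>) * ennreal (normal_density 0 \<sigma> t) \<partial>lborel)
         = ennreal (\<sigma> powr \<gamma> * 2 powr (\<gamma> / 2) * Gamma ((\<gamma> + 1) / 2) / sqrt pi)"
proof -
  let ?f = "\<lambda>r::real. ennreal (r powr \<gamma> * exp (- r\<^sup>2 / 2)) * indicator {0<..} r"
  let ?C = "\<sigma> powr \<gamma> / sqrt (2 * pi)"
  let ?G = "2 powr ((\<gamma> - 1) / 2) * Gamma ((\<gamma> + 1) / 2)"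
  have G: "0 \<le> ?G" using Gamma_real_pos[of "(\<gamma> + 1) / 2"] \<gamma> by simp
  have "(\<integral>\<^sup>+t. ennreal (\<bar>t\<bar> powr \<gamma>) * ennreal (normal_density 0 \<sigma> t) \<partial>lborel)
     = \<sigma> * (\<integral>\<^sup>+t. ennreal (\<bar>\<sigma> * t\<bar> powr \<gamma>) * ennreal (normal_density 0 \<sigma> (\<sigma> * t)) \<partial>lborel)"
    using \<sigma> by (subst nn_integral_real_affine[where c = \<sigma> and t = 0]) (simp_all)
  also have "\<dots> = (\<integral>\<^sup>+t. ennreal ?C * ennreal (\<bar>t\<bar> powr \<gamma> * exp (- t\<^sup>2 / 2)) \<partial>lborel)"
  proof -
    have "\<sigma> * (\<bar>\<sigma> * t\<bar> powr \<gamma> * normal_density 0 \<sigma> (\<sigma> * t)) = ?C * (\<bar>t\<bar> powr \<gamma> * exp (- t\<^sup>2 / 2))" for t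
      using \<sigma> by (simp add: normal_density_def abs_mult powr_mult power_mult_distrib real_sqrt_mult)
    then have "ennreal \<sigma> * (ennreal (\<bar>\<sigma> * t\<bar> powr \<gamma>) * ennreal (normal_density 0 \<sigma> (\<sigma> * t)))
        = ennreal ?C * ennreal (\<bar>t\<bar> powr \<gamma> * exp (- t\<^sup>2 / 2))" for t
      using \<sigma> by (simp flip: ennreal_mult)
    then show ?thesis by (subst nn_integral_cmult[symmetric]) simp_all
  qed
  also have "\<dots> = ennreal ?C * (\<integral>\<^sup>+t. ennreal (\<bar>t\<bar> powr \<gamma> * exp (- t\<^sup>2 / 2)) \<partial>lborel)"
    by (rule nn_integral_cmult) measurable
  also have "(\<integral>\<^sup>+t. ennreal (\<bar>t\<bar> powr \<gamma> * exp (- t\<^sup>2 / 2)) \<partial>lborel) = (\<integral>\<^sup>+t. ?f t + ?f (- t) \<partial>lborel)"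
    by (rule nn_integral_cong_AE) (auto intro!: AE_I[of _ _ "{0}"] simp: indicator_def split: if_splits)
  also have "\<dots> = (\<integral>\<^sup>+t. ?f t \<partial>lborel) + (\<integral>\<^sup>+t. ?f (- t) \<partial>lborel)"
    by (rule nn_integral_add) measurable
  also have "(\<integral>\<^sup>+t. ?f (- t) \<partial>lborel) = (\<integral>\<^sup>+t. ?f t \<partial>lborel)"
    by (subst (2) nn_integral_real_affine[where c = "- 1" and t = 0]) simp_all
  also have "(\<integral>\<^sup>+t. ?f t \<partial>lborel) = ennreal ?G"
    using \<gamma> by (rule nn_integral_gaussian_moment)
  also have "ennreal ?C * (ennreal ?G + ennreal ?G) = ennreal (?C * (2 * ?G))"
  proof -
    have "ennreal c * (ennreal g + ennreal g) = ennreal (c * (2 * g))" if "0 \<le> c" "0 \<le> g" for c g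
      using that by (simp flip: ennreal_mult ennreal_plus)
    then show ?thesis using G by simp
  qed
  also have "?C * (2 * ?G) = \<sigma> powr \<gamma> * 2 powr (\<gamma> / 2) * Gamma ((\<gamma> + 1) / 2) / sqrt pi"
  proof -
    have "2 * 2 powr ((\<gamma> - 1) / 2) = sqrt 2 * 2 powr (\<gamma> / 2)"
    proof -
      have "2 * 2 powr ((\<gamma> - 1) / 2) = 2 powr (1 + (\<gamma> - 1) / 2)" by (simp add: powr_add)
      also have "1 + (\<gamma> - 1) / 2 = 1 / 2 + \<gamma> / 2" by (simp add: field_simps)
      also have "2 powr \<dots> = sqrt 2 * 2 powr (\<gamma> / 2)" by (simp add: powr_add powr_half_sqrt)
      finally show ?thesis .
    qed
    note e = this
    have "?C * (2 * ?G) = \<sigma> powr \<gamma> / (sqrt 2 * sqrt pi) * ((2 * 2 powr ((\<gamma> - 1) / 2)) * Gamma ((\<gamma> + 1) / 2))"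
      by (simp add: real_sqrt_mult)
    then show ?thesis unfolding e by simp
  qed
  finally show ?thesis .
qed

section \<open>The standard Gaussian vector and its linear forms\<close>

text \<open>The product form gives the independence of the coordinates; the radial form, needed for
  polar coordinates, is derived in \<open>gaussian_density_eq\<close>.\<close>

definition gaussian_density :: "'a::euclidean_space \<Rightarrow> real" where
  "gaussian_density y = (\<Prod>b\<in>Basis. std_normal_density (y \<bullet> b))"

lemma gaussian_density_nonneg: "0 \<le> gaussian_density y"
  unfolding gaussian_density_def by (intro prod_nonneg) simp

lemma borel_measurable_gaussian_density [measurable]:
  "(gaussian_density :: 'a::euclidean_space \<Rightarrow> real) \<in> borel_measurable borel"
  unfolding gaussian_density_def[abs_def] by measurable

lemma gaussian_density_eq:
  fixes y :: "'a::euclidean_space"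
  shows "gaussian_density y = (2 * pi) powr (- real DIM('a) / 2) * exp (- (norm y)\<^sup>2 / 2)"
proof -
  have "gaussian_density y = (\<Prod>b\<in>(Basis::'a set). 1 / sqrt (2 * pi)) * (\<Prod>b\<in>Basis. exp (- (y \<bullet> b)\<^sup>2 / 2))"
    unfolding gaussian_density_def std_normal_density_def by (rule prod.distrib)
  also have "(\<Prod>b\<in>(Basis::'a set). 1 / sqrt (2 * pi)) = (2 * pi) powr (- real DIM('a) / 2)"
  proof -
    have "1 / sqrt (2 * pi) = (2 * pi) powr (- 1 / 2)"
      by (simp add: powr_minus_divide powr_half_sqrt)
    then show ?thesis
      by (simp add: powr_powr flip: powr_realpow)
  qed
  also have "(\<Prod>b\<in>Basis. exp (- (y \<bullet> b)\<^sup>2 / 2)) = exp (- (norm y)\<^sup>2 / 2)"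
  proof -
    have "(norm y)\<^sup>2 = (\<Sum>b\<in>Basis. (y \<bullet> b)\<^sup>2)"
      unfolding power2_norm_eq_inner by (subst euclidean_inner) (simp add: power2_eq_square)
    then show ?thesis
      by (simp add: exp_sum[symmetric] sum_negf sum_divide_distrib[symmetric])
  qed
  finally show ?thesis .
qed

text \<open>Both the density and the indicator of a box factor over the coordinates, so Tonelli
  applies. Total mass 1, the law of each coordinate and the independence of the coordinates all
  follow by choosing the sides \<open>A\<close>.\<close>

lemma emeasure_gaussian_box:
  fixes A :: "'a::euclidean_space \<Rightarrow> real set"
  assumes A[measurable]: "\<And>b. b \<in> Basis \<Longrightarrow> A b \<in> sets borel"
  shows "emeasure (density lborel (gaussian_density :: 'a \<Rightarrow> real)) {y. \<forall>b\<in>Basis. y \<bullet> b \<in> A b}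
         = (\<Prod>b\<in>Basis. emeasure (density lborel std_normal_density) (A b))"
proof -
  have m: "{y. \<forall>b\<in>Basis. y \<bullet> b \<in> A b} \<in> sets (borel :: 'a measure)"
  proof -
    have "{y. \<forall>b\<in>Basis. y \<bullet> b \<in> A b} = (\<Inter>b\<in>Basis. (\<lambda>y. y \<bullet> b) -` A b \<inter> space borel)" by auto
    also have "\<dots> \<in> sets borel"
    proof (intro sets.finite_INT)
      show "(\<lambda>y. y \<bullet> b) -` A b \<inter> space borel \<in> sets borel" if "b \<in> Basis" for b :: 'a
        by (rule measurable_sets[OF _ A[OF that]]) measurable
    qed auto
    finally show ?thesis .
  qed
  have "emeasure (density lborel (gaussian_density :: 'a \<Rightarrow> real)) {y. \<forall>b\<in>Basis. y \<bullet> b \<in> A b}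
      = (\<integral>\<^sup>+y. ennreal (gaussian_density y) * indicator {y::'a. \<forall>b\<in>Basis. y \<bullet> b \<in> A b} y \<partial>lborel)"
    using m by (intro emeasure_density) auto
  also have "\<dots> = (\<integral>\<^sup>+y. (\<Prod>b\<in>(Basis::'a set). ennreal (std_normal_density (y \<bullet> b) * indicator (A b) (y \<bullet> b))) \<partial>lborel)"
  proof (intro nn_integral_cong)
    fix y :: 'a
    have "(\<Prod>b\<in>Basis. ennreal (std_normal_density (y \<bullet> b) * indicator (A b) (y \<bullet> b)))
        = ennreal (\<Prod>b\<in>Basis. std_normal_density (y \<bullet> b) * indicator (A b) (y \<bullet> b))"
      by (intro prod_ennreal) simp
    also have "(\<Prod>b\<in>Basis. std_normal_density (y \<bullet> b) * indicator (A b) (y \<bullet> b))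
        = gaussian_density y * (\<Prod>b\<in>Basis. indicator (A b) (y \<bullet> b))"
      by (simp add: gaussian_density_def prod.distrib)
    also have "(\<Prod>b\<in>Basis. indicator (A b) (y \<bullet> b)) = (indicator {y::'a. \<forall>b\<in>Basis. y \<bullet> b \<in> A b} y :: real)"
    proof (cases "\<forall>b\<in>Basis. y \<bullet> b \<in> A b")
      case False
      then show ?thesis by (auto simp: indicator_def)
    qed simp
    finally show "ennreal (gaussian_density y) * indicator {y::'a. \<forall>b\<in>Basis. y \<bullet> b \<in> A b} y
        = (\<Prod>b\<in>Basis. ennreal (std_normal_density (y \<bullet> b) * indicator (A b) (y \<bullet> b)))"
      by (simp add: indicator_def)
  qed
  also have "\<dots> = (\<Prod>b\<in>(Basis::'a set). \<integral>\<^sup>+t. ennreal (std_normal_density t * indicator (A b) t) \<partial>lborel)"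
    by (rule nn_integral_lborel_prod) auto
  also have "\<dots> = (\<Prod>b\<in>(Basis::'a set). emeasure (density lborel std_normal_density) (A b))"
    by (intro prod.cong refl) (simp add: emeasure_density ennreal_mult' ennreal_indicator)
  finally show ?thesis .
qed

lemma prob_space_std_normal: "prob_space (density lborel std_normal_density)"
  by (rule prob_space_normal_density) simp

lemma prob_space_gaussian: "prob_space (density lborel (gaussian_density :: 'a::euclidean_space \<Rightarrow> real))"
proof
  interpret Z: prob_space "density lborel std_normal_density" by (rule prob_space_std_normal)
  show "emeasure (density lborel (gaussian_density :: 'a \<Rightarrow> real)) (space (density lborel gaussian_density)) = 1"
    using emeasure_gaussian_box[of "\<lambda>_::'a. UNIV"] Z.emeasure_space_1 by simp
qed

lemma distr_gaussian_component:
  fixes b :: "'a::euclidean_space"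
  assumes b: "b \<in> Basis"
  shows "distr (density lborel (gaussian_density :: 'a \<Rightarrow> real)) borel (\<lambda>y. y \<bullet> b) = density lborel std_normal_density"
proof (rule measure_eqI)
  interpret Z: prob_space "density lborel std_normal_density" by (rule prob_space_std_normal)
  fix A assume "A \<in> sets (distr (density lborel (gaussian_density :: 'a \<Rightarrow> real)) borel (\<lambda>y. y \<bullet> b))"
  then have A: "A \<in> sets borel" by simp
  \<comment> \<open>A slab as a box: all sides other than \<open>b\<close> contribute the factor
    1.\<close>
  let ?A = "\<lambda>c. if c = b then A else UNIV"
  have "(\<lambda>y::'a. y \<bullet> b) -` A = {y. \<forall>c\<in>Basis. y \<bullet> c \<in> ?A c}"
    using b by auto
  then have "emeasure (distr (density lborel (gaussian_density :: 'a \<Rightarrow> real)) borel (\<lambda>y. y \<bullet> b)) A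
      = (\<Prod>c\<in>(Basis::'a set). emeasure (density lborel std_normal_density) (?A c))"
    using A by (subst emeasure_gaussian_box[symmetric]) (auto simp: emeasure_distr)
  also have "\<dots> = emeasure (density lborel std_normal_density) A"
    using b Z.emeasure_space_1 by (simp add: prod.remove[of _ b])
  finally show "emeasure (distr (density lborel (gaussian_density :: 'a \<Rightarrow> real)) borel (\<lambda>y. y \<bullet> b)) A
      = emeasure (density lborel std_normal_density) A" .
qed simp

text \<open>Independence means that the joint law is the product of the marginal laws, and boxes
  determine a measure on a finite product.\<close>

lemma indep_vars_gaussian_components:
  "prob_space.indep_vars (density lborel (gaussian_density :: 'a::euclidean_space \<Rightarrow> real))
     (\<lambda>_. borel) (\<lambda>b y. y \<bullet> b) Basis"
proof -
  let ?N = "density lborel (gaussian_density :: 'a \<Rightarrow> real)"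
  let ?Z = "density lborel std_normal_density"
  interpret N: prob_space ?N by (rule prob_space_gaussian)
  interpret Z: prob_space ?Z by (rule prob_space_std_normal)
  interpret P: product_sigma_finite "\<lambda>_::'a. ?Z" by standard
  have sets: "sets (Pi\<^sub>M Basis (\<lambda>_::'a. ?Z)) = sets (Pi\<^sub>M Basis (\<lambda>_. borel))"
    by (intro sets_PiM_cong) simp_all
  have "distr ?N (\<Pi>\<^sub>M b\<in>Basis. borel) (\<lambda>y. \<lambda>b\<in>Basis. y \<bullet> b) = (\<Pi>\<^sub>M b\<in>(Basis::'a set). ?Z)"
  proof (rule P.PiM_eqI)
    fix A :: "'a \<Rightarrow> real set" assume "\<And>b. b \<in> Basis \<Longrightarrow> A b \<in> sets ?Z"
    then have A: "\<And>b. b \<in> Basis \<Longrightarrow> A b \<in> sets borel" by simp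
    have "(\<lambda>y::'a. \<lambda>b\<in>Basis. y \<bullet> b) -` (Pi\<^sub>E Basis A) = {y. \<forall>b\<in>Basis. y \<bullet> b \<in> A b}" by auto
    then show "emeasure (distr ?N (\<Pi>\<^sub>M b\<in>Basis. borel) (\<lambda>y. \<lambda>b\<in>Basis. y \<bullet> b)) (Pi\<^sub>E Basis A)
        = (\<Prod>b\<in>Basis. emeasure ?Z (A b))"
      using A by (subst emeasure_distr) (auto simp: emeasure_gaussian_box intro!: sets_PiM_I_finite measurable_restrict)
  qed (simp_all add: sets)
  also have "\<dots> = (\<Pi>\<^sub>M b\<in>Basis. distr ?N borel (\<lambda>y. y \<bullet> b))"
    by (intro PiM_cong refl) (simp add: distr_gaussian_component)
  finally show ?thesis
    by (subst N.indep_vars_iff_distr_eq_PiM') auto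
qed

lemma distributed_gaussian_linear_form:
  fixes x :: "'a::euclidean_space"
  assumes x: "x \<noteq> 0"
  shows "distributed (density lborel (gaussian_density :: 'a \<Rightarrow> real)) lborel (\<lambda>y. x \<bullet> y) (normal_density 0 (norm x))"
proof -
  let ?N = "density lborel (gaussian_density :: 'a \<Rightarrow> real)"
  interpret N: prob_space ?N by (rule prob_space_gaussian)
  \<comment> \<open>A summand with coefficient 0 would be a degenerate normal variable without
    density; \<open>x \<noteq> 0\<close> keeps the index set nonempty.\<close>
  let ?I = "{b\<in>Basis. x \<bullet> b \<noteq> 0}"
  have I: "finite ?I" "?I \<noteq> {}" using x euclidean_all_zero_iff[of x] by auto
  have "N.indep_vars (\<lambda>_. borel) (\<lambda>b y. y \<bullet> b) ?I"
    by (rule N.indep_vars_subset[OF indep_vars_gaussian_components]) auto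
  then have ind: "N.indep_vars (\<lambda>_. borel) (\<lambda>b y. (x \<bullet> b) * (y \<bullet> b)) ?I"
    by (rule N.indep_vars_compose2) measurable
  have norm: "distributed ?N lborel (\<lambda>y. (x \<bullet> b) * (y \<bullet> b)) (normal_density 0 \<bar>x \<bullet> b\<bar>)" if "b \<in> ?I" for b
  proof -
    have "distributed ?N lborel (\<lambda>y. y \<bullet> b) std_normal_density"
      using that distr_gaussian_component[of b] unfolding distributed_def by (simp cong: distr_cong)
    from N.normal_density_affine[OF this, of "x \<bullet> b" 0] that show ?thesis by simp
  qed
  have "distributed ?N lborel (\<lambda>y. \<Sum>b\<in>?I. (x \<bullet> b) * (y \<bullet> b)) (normal_density (\<Sum>b\<in>?I. 0) (sqrt (\<Sum>b\<in>?I. \<bar>x \<bullet> b\<bar>\<^sup>2)))"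
    using norm by (intro N.sum_indep_normal I ind) auto
  moreover have "(\<Sum>b\<in>?I. (x \<bullet> b) * (y \<bullet> b)) = x \<bullet> y" for y
    by (subst euclidean_inner[of x y]) (auto intro!: sum.mono_neutral_left)
  moreover have "(\<Sum>b\<in>?I. \<bar>x \<bullet> b\<bar>\<^sup>2) = x \<bullet> x"
    by (subst euclidean_inner[of x x]) (auto intro!: sum.mono_neutral_cong_left simp: power2_eq_square)
  ultimately show ?thesis by (simp add: norm_eq_sqrt_inner)
qed

section \<open>Absolute moments of the surface measure\<close>

lemma nn_integral_sphere_measure:
  fixes f :: "'a::euclidean_space \<Rightarrow> ennreal"
  assumes [measurable]: "f \<in> borel_measurable borel"
  shows "(\<integral>\<^sup>+v. f v \<partial>sphere_measure)
         = ennreal (real DIM('a)) * (\<integral>\<^sup>+y. f (y /\<^sub>R norm y) * indicator (cball 0 1 - {0}) y \<partial>lborel)"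
proof -
  have "f \<in> borel_measurable (restrict_space borel (sphere 0 1))"
    by (rule measurable_restrict_space1) measurable
  then have "(\<integral>\<^sup>+v. f v \<partial>sphere_measure) = ennreal (real DIM('a))
      * (\<integral>\<^sup>+y. f (y /\<^sub>R norm y) \<partial>restrict_space lborel (cball 0 1 - {0}))"
    unfolding sphere_measure_def
    by (subst nn_integral_scale_measure, simp)
       (subst nn_integral_distr[OF measurable_radial_projection], simp_all)
  then show ?thesis
    by (subst (asm) nn_integral_restrict_space) auto
qed

lemma finite_measure_sphere_measure: "finite_measure (sphere_measure :: 'a::euclidean_space measure)"
proof
  have "(\<integral>\<^sup>+y. 1 * indicator (cball (0::'a) 1 - {0}) y \<partial>lborel) \<le> emeasure lborel (cball (0::'a) 1)"
    by (auto intro!: emeasure_mono)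
  also have "\<dots> < \<infinity>" by (rule emeasure_lborel_cball_finite)
  finally have "emeasure (sphere_measure :: 'a measure) (space sphere_measure) < \<infinity>"
    using nn_integral_sphere_measure[of "\<lambda>_::'a. 1"] by (simp add: ennreal_mult_less_top)
  then show "emeasure (sphere_measure :: 'a measure) (space sphere_measure) \<noteq> \<infinity>" by simp
qed

lemma nn_integral_abs_gaussian_linear_form:
  fixes x :: "'a::euclidean_space"
  assumes x: "x \<noteq> 0" and \<gamma>: "- 1 < \<gamma>"
  shows "(\<integral>\<^sup>+y. ennreal (gaussian_density y) * ennreal (\<bar>x \<bullet> y\<bar> powr \<gamma>) \<partial>lborel)
         = ennreal (norm x powr \<gamma> * 2 powr (\<gamma> / 2) * Gamma ((\<gamma> + 1) / 2) / sqrt pi)"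
proof -
  have "(\<integral>\<^sup>+y. ennreal (gaussian_density y) * ennreal (\<bar>x \<bullet> y\<bar> powr \<gamma>) \<partial>lborel)
      = (\<integral>\<^sup>+y. ennreal (\<bar>x \<bullet> y\<bar> powr \<gamma>) \<partial>density lborel gaussian_density)"
    by (simp add: nn_integral_density)
  also have "\<dots> = (\<integral>\<^sup>+t. ennreal (normal_density 0 (norm x) t) * ennreal (\<bar>t\<bar> powr \<gamma>) \<partial>lborel)"
    by (rule distributed_nn_integral[OF distributed_gaussian_linear_form[OF x], symmetric]) measurable
  also have "\<dots> = ennreal (norm x powr \<gamma> * 2 powr (\<gamma> / 2) * Gamma ((\<gamma> + 1) / 2) / sqrt pi)"
    using nn_integral_abs_normal_moment[of \<gamma> "norm x"] x \<gamma> by (simp add: mult.commute)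
  finally show ?thesis .
qed

text \<open>The integral of |<e, v>|^\<gamma> over the unit sphere for a unit vector e. At \<gamma>
  = 0 the formula is the surface area 2 pi^(d/2) / Gamma (d/2); for d = 1 it is 2, the mass of two
  points.\<close>

definition sphere_moment :: "nat \<Rightarrow> real \<Rightarrow> real" where
  "sphere_moment d \<gamma> = 2 * pi powr ((real d - 1) / 2) * Gamma ((\<gamma> + 1) / 2) / Gamma ((real d + \<gamma>) / 2)"

text \<open>The integral of |<x, y>|^\<gamma> exp (- |y|^2 / 2) is evaluated in two ways. As a
  moment of the normal variable <x, y> it is \<open>c0\<close>; in polar coordinates it is
  \<open>G\<close> times the radial integral \<open>?d * c1\<close>, and \<open>?d * G\<close> is
  the integral over the sphere.\<close>

lemma nn_integral_sphere_abs_inner: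
  fixes x :: "'a::euclidean_space"
  assumes \<gamma>: "0 < \<gamma>"
  shows "(\<integral>\<^sup>+v. ennreal (\<bar>x \<bullet> v\<bar> powr \<gamma>) \<partial>sphere_measure) = ennreal (sphere_moment DIM('a) \<gamma> * norm x powr \<gamma>)"
proof (cases "x = 0")
  case True
  then show ?thesis using \<gamma> by simp
next
  case False
  let ?d = "real DIM('a)"
  let ?h = "\<lambda>y::'a. ennreal (\<bar>x \<bullet> (y /\<^sub>R norm y)\<bar> powr \<gamma>)"
  let ?w = "\<lambda>r::real. ennreal (r powr \<gamma> * exp (- r\<^sup>2 / 2))"
  define G where "G = (\<integral>\<^sup>+y. ?h y * indicator (cball 0 1) y \<partial>lborel)"
  define c0 where "c0 = (2 * pi) powr (?d / 2) * (norm x powr \<gamma> * 2 powr (\<gamma> / 2) * Gamma ((\<gamma> + 1) / 2) / sqrt pi)"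
  define c1 where "c1 = 2 powr ((\<gamma> + ?d - 2) / 2) * Gamma ((\<gamma> + ?d) / 2)"
  have d1: "1 \<le> ?d" by (simp add: Suc_le_eq)
  have c1: "0 < c1" unfolding c1_def using \<gamma> d1 by (intro mult_pos_pos Gamma_real_pos) auto
  have h_le: "?h y \<le> ennreal (norm x powr \<gamma>)" for y
  proof -
    have "\<bar>x \<bullet> (y /\<^sub>R norm y)\<bar> \<le> norm x * norm (y /\<^sub>R norm y)" by (rule Cauchy_Schwarz_ineq2)
    also have "\<dots> \<le> norm x" by (cases "y = 0") simp_all
    finally show ?thesis using \<gamma> by (intro ennreal_leI powr_mono2) auto
  qed
  have fin: "G < \<infinity>"
  proof -
    have "G \<le> (\<integral>\<^sup>+y. ennreal (norm x powr \<gamma>) * indicator (cball (0::'a) 1) y \<partial>lborel)"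
      unfolding G_def by (intro nn_integral_mono mult_right_mono h_le) simp
    also have "\<dots> < \<infinity>"
      using emeasure_lborel_cball_finite[of "0::'a" 1]
      by (subst nn_integral_cmult_indicator) (auto simp: ennreal_mult_less_top)
    finally show ?thesis .
  qed
  have "(\<integral>\<^sup>+v. ennreal (\<bar>x \<bullet> v\<bar> powr \<gamma>) \<partial>sphere_measure)
      = ennreal ?d * (\<integral>\<^sup>+y. ?h y * indicator (cball 0 1 - {0}) y \<partial>lborel)"
    by (rule nn_integral_sphere_measure) measurable
  \<comment> \<open>At the origin \<open>?h\<close> is \<open>0 powr \<gamma> = 0\<close>, so
    filling the puncture changes nothing, even pointwise.\<close>
  also have "(\<integral>\<^sup>+y. ?h y * indicator (cball 0 1 - {0}) y \<partial>lborel) = G"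
    unfolding G_def by (intro nn_integral_cong) (auto simp: indicator_def)
  finally have sph: "(\<integral>\<^sup>+v. ennreal (\<bar>x \<bullet> v\<bar> powr \<gamma>) \<partial>sphere_measure) = ennreal ?d * G" .
  have "(\<integral>\<^sup>+y. ?h y * ?w (norm y) \<partial>lborel)
      = G * (\<integral>\<^sup>+r. ennreal (?d * r ^ (DIM('a) - 1)) * indicator {0<..} r * ?w r \<partial>lborel)"
  proof -
    have hom: "(r *\<^sub>R y) /\<^sub>R norm (r *\<^sub>R y) = y /\<^sub>R norm y" if "0 < r" for r and y :: 'a
      using that by (cases "y = 0") (simp_all add: field_simps)
    show ?thesis
      unfolding G_def by (rule nn_integral_polar) (use fin in \<open>simp_all only: hom G_def, measurable\<close>)
  qed
  also have "(\<integral>\<^sup>+r. ennreal (?d * r ^ (DIM('a) - 1)) * indicator {0<..} r * ?w r \<partial>lborel)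
      = (\<integral>\<^sup>+r. ennreal ?d * (ennreal (r powr (\<gamma> + ?d - 1) * exp (- r\<^sup>2 / 2)) * indicator {0<..} r) \<partial>lborel)"
  proof (intro nn_integral_cong)
    fix r :: real
    have "?d * r ^ (DIM('a) - 1) * (r powr \<gamma> * exp (- r\<^sup>2 / 2)) = ?d * (r powr (\<gamma> + ?d - 1) * exp (- r\<^sup>2 / 2))"
      if r: "0 < r"
    proof -
      have "r ^ (DIM('a) - 1) = r powr (?d - 1)"
        using r d1 by (subst powr_realpow[symmetric]) (auto simp: of_nat_diff)
      then have "r ^ (DIM('a) - 1) * r powr \<gamma> = r powr (\<gamma> + ?d - 1)"
        by (simp add: add.commute add_diff_eq flip: powr_add)
      then show ?thesis by (simp add: mult.assoc[symmetric])
    qed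
    then show "ennreal (?d * r ^ (DIM('a) - 1)) * indicator {0<..} r * ?w r
        = ennreal ?d * (ennreal (r powr (\<gamma> + ?d - 1) * exp (- r\<^sup>2 / 2)) * indicator {0<..} r)"
      by (cases "0 < r") (simp_all flip: ennreal_mult)
  qed
  also have "\<dots> = ennreal (?d * c1)"
  proof -
    have "(\<integral>\<^sup>+r. ennreal (r powr (\<gamma> + ?d - 1) * exp (- r\<^sup>2 / 2)) * indicator {0<..} r \<partial>lborel) = ennreal c1"
      using nn_integral_gaussian_moment[of "\<gamma> + ?d - 1"] \<gamma> d1 by (simp add: c1_def)
    then show ?thesis by (simp add: nn_integral_cmult ennreal_mult')
  qed
  also have "(\<integral>\<^sup>+y. ?h y * ?w (norm y) \<partial>lborel)
      = (\<integral>\<^sup>+y. ennreal ((2 * pi) powr (?d / 2)) * (ennreal (gaussian_density y) * ennreal (\<bar>x \<bullet> y\<bar> powr \<gamma>)) \<partial>lborel)"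
  proof (intro nn_integral_cong)
    fix y :: 'a
    have A: "\<bar>x \<bullet> (y /\<^sub>R norm y)\<bar> powr \<gamma> * norm y powr \<gamma> = \<bar>x \<bullet> y\<bar> powr \<gamma>"
    proof -
      have "\<bar>x \<bullet> (y /\<^sub>R norm y)\<bar> * norm y = \<bar>x \<bullet> y\<bar>"
        by (cases "y = 0") (simp_all add: abs_mult field_simps)
      then show ?thesis by (simp only: powr_mult[symmetric] abs_ge_zero norm_ge_zero)
    qed
    have B: "(2 * pi) powr (?d / 2) * gaussian_density y = exp (- (norm y)\<^sup>2 / 2)"
      by (simp add: gaussian_density_eq powr_minus_divide)
    have "\<bar>x \<bullet> (y /\<^sub>R norm y)\<bar> powr \<gamma> * (norm y powr \<gamma> * exp (- (norm y)\<^sup>2 / 2))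
        = (2 * pi) powr (?d / 2) * (gaussian_density y * \<bar>x \<bullet> y\<bar> powr \<gamma>)"
      unfolding A[symmetric] B[symmetric] by (simp only: mult_ac)
    then show "?h y * ?w (norm y)
        = ennreal ((2 * pi) powr (?d / 2)) * (ennreal (gaussian_density y) * ennreal (\<bar>x \<bullet> y\<bar> powr \<gamma>))"
      using gaussian_density_nonneg[of y] by (simp flip: ennreal_mult)
  qed
  also have "\<dots> = ennreal c0"
  proof -
    have "(\<integral>\<^sup>+y. ennreal (gaussian_density y) * ennreal (\<bar>x \<bullet> y\<bar> powr \<gamma>) \<partial>lborel)
        = ennreal (norm x powr \<gamma> * 2 powr (\<gamma> / 2) * Gamma ((\<gamma> + 1) / 2) / sqrt pi)"
      using \<gamma> by (intro nn_integral_abs_gaussian_linear_form[OF False]) simp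
    then show ?thesis
      unfolding c0_def ennreal_mult'[OF powr_ge_zero]
      by (subst nn_integral_cmult) simp_all
  qed
  finally have eq: "ennreal c0 = G * ennreal (?d * c1)" .
  obtain g where g: "G = ennreal g" "0 \<le> g" using fin by (cases G) auto
  have c0: "0 \<le> c0"
    unfolding c0_def using \<gamma> by (intro mult_nonneg_nonneg divide_nonneg_nonneg less_imp_le[OF Gamma_real_pos]) auto
  \<comment> \<open>Finiteness of \<open>G\<close> moves the equation from extended to real numbers,
    where division by \<open>c1 > 0\<close> isolates the sphere integral
    \<open>?d * g\<close>.\<close>
  have "c0 = g * (?d * c1)"
    using eq g c0 c1 by (simp flip: ennreal_mult)
  then have "?d * g = c0 / c1" using c1 by (simp add: field_simps)
  also have "c0 / c1 = sphere_moment DIM('a) \<gamma> * norm x powr \<gamma>"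
  proof -
    have p: "(2 * pi) powr (?d / 2) / sqrt pi = 2 powr (?d / 2) * pi powr ((?d - 1) / 2)"
    proof -
      have "pi powr ((?d - 1) / 2) = pi powr (?d / 2 - 1 / 2)" by (simp add: diff_divide_distrib)
      also have "\<dots> = pi powr (?d / 2) / sqrt pi" by (simp add: powr_diff powr_half_sqrt)
      finally show ?thesis by (simp add: powr_mult)
    qed
    have t: "2 powr (?d / 2) * 2 powr (\<gamma> / 2) = 2 * 2 powr ((\<gamma> + ?d - 2) / 2)"
    proof -
      have "2 powr (?d / 2) * 2 powr (\<gamma> / 2) = 2 powr (1 + (\<gamma> + ?d - 2) / 2)"
        by (simp add: field_simps flip: powr_add)
      then show ?thesis by (simp add: powr_add)
    qed
    have "c0 = ((2 * pi) powr (?d / 2) / sqrt pi) * 2 powr (\<gamma> / 2) * (norm x powr \<gamma> * Gamma ((\<gamma> + 1) / 2))"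
      by (simp add: c0_def)
    also have "\<dots> = (2 powr (?d / 2) * 2 powr (\<gamma> / 2)) * (pi powr ((?d - 1) / 2) * (norm x powr \<gamma> * Gamma ((\<gamma> + 1) / 2)))"
      unfolding p by (simp only: mult_ac)
    finally show ?thesis
      unfolding c1_def t sphere_moment_def by (simp add: add.commute)
  qed
  finally show ?thesis
    unfolding sph g(1) using g(2) by (simp flip: ennreal_mult)
qed

section \<open>Means of square integrable differences\<close>

lemma distr_pair_snd:
  assumes "prob_space M" "prob_space N"
  shows "distr (M \<Otimes>\<^sub>M N) N snd = N"
proof -
  interpret M: prob_space M by fact
  interpret N: prob_space N by fact
  interpret P: pair_sigma_finite M N ..
  have "distr (M \<Otimes>\<^sub>M N) N snd = distr (distr (N \<Otimes>\<^sub>M M) (M \<Otimes>\<^sub>M N) (\<lambda>(x, y). (y, x))) N snd"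
    by (subst P.distr_pair_swap) simp
  also have "\<dots> = distr (N \<Otimes>\<^sub>M M) N fst"
    by (subst distr_distr) (auto simp: comp_def case_prod_beta')
  also have "\<dots> = N" by (rule M.distr_pair_fst)
  finally show ?thesis .
qed

lemma distr_pair_marginals:
  assumes A: "prob_space A" and B: "prob_space B"
    and f: "f \<in> measurable A S" and g: "g \<in> measurable B T"
    and S: "distr A S f = S" and T: "distr B T g = T"
  shows "distr (A \<Otimes>\<^sub>M B) (S \<Otimes>\<^sub>M T) (\<lambda>z. (f (fst z), g (snd z))) = S \<Otimes>\<^sub>M T"
proof -
  interpret T: prob_space "distr B T g" using B g by (rule prob_space.prob_space_distr)
  have "distr A S f \<Otimes>\<^sub>M distr B T g = distr (A \<Otimes>\<^sub>M B) (S \<Otimes>\<^sub>M T) (\<lambda>(x, y). (f x, g y))"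
    by (rule pair_measure_distr[OF f g]) unfold_locales
  then show ?thesis by (simp add: S T case_prod_beta')
qed

lemma has_bochner_integral_distr_eq:
  fixes k :: "'b \<Rightarrow> real"
  assumes "distr P N T = N" "T \<in> measurable P N" "integrable N k"
  shows "has_bochner_integral P (\<lambda>z. k (T z)) (integral\<^sup>L N k)"
  using assms integrable_distr[of T P N k] integral_distr[of T P N k]
  by (auto simp: has_bochner_integral_iff)

text \<open>The independence of the two variables is what makes each of them integrable separately.\<close>

lemma integrable_pair_diff:
  fixes f :: "'a \<Rightarrow> real" and g :: "'b \<Rightarrow> real"
  assumes "prob_space \<mu>" "prob_space \<nu>"
    and D: "integrable (\<mu> \<Otimes>\<^sub>M \<nu>) (\<lambda>q. f (fst q) - g (snd q))"
  shows "integrable \<mu> f" "integrable \<nu> g"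
    and "(\<integral>q. f (fst q) - g (snd q) \<partial>(\<mu> \<Otimes>\<^sub>M \<nu>)) = (\<integral>x. f x \<partial>\<mu>) - (\<integral>y. g y \<partial>\<nu>)"
proof -
  interpret M: prob_space \<mu> by fact
  interpret N: prob_space \<nu> by fact
  interpret P: pair_prob_space \<mu> \<nu> ..
  interpret P': pair_prob_space \<nu> \<mu> ..
  have "AE x in \<mu>. integrable \<nu> (\<lambda>y. f x - g y)"
    using P.AE_integrable_fst'[OF D] by simp
  \<comment> \<open>One good section suffices: for fixed \<open>x\<close> the number
    \<open>f x\<close> is a constant, hence integrable against a probability measure.\<close>
  then obtain x where "integrable \<nu> (\<lambda>y. f x - g y)"
    using M.AE_False by (metis (mono_tags, lifting) eventually_mono)
  then have "integrable \<nu> (\<lambda>y. f x - (f x - g y))"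
    by (rule Bochner_Integration.integrable_diff[rotated]) simp
  then show g: "integrable \<nu> g" by simp
  have "AE y in \<nu>. integrable \<mu> (\<lambda>x. f x - g y)"
    using P'.AE_integrable_fst'[OF P.integrable_product_swap[OF D]] by simp
  then obtain y where "integrable \<mu> (\<lambda>x. f x - g y)"
    using N.AE_False by (metis (mono_tags, lifting) eventually_mono)
  then have "integrable \<mu> (\<lambda>x. f x - g y + g y)"
    by (rule Bochner_Integration.integrable_add) simp
  then show f: "integrable \<mu> f" by simp
  have "has_bochner_integral (\<mu> \<Otimes>\<^sub>M \<nu>) (\<lambda>q. f (fst q) - g (snd q)) (integral\<^sup>L \<mu> f - integral\<^sup>L \<nu> g)"
    using f g N.distr_pair_fst[of \<mu>] distr_pair_snd[OF assms(1,2)]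
    by (intro has_bochner_integral_diff has_bochner_integral_distr_eq) auto
  then show "(\<integral>q. f (fst q) - g (snd q) \<partial>(\<mu> \<Otimes>\<^sub>M \<nu>)) = (\<integral>x. f x \<partial>\<mu>) - (\<integral>y. g y \<partial>\<nu>)"
    by (rule has_bochner_integral_integral_eq)
qed

text \<open>The bound |ab| \<le> a^2 + b^2 makes the product of two independent copies of
  \<open>D\<close> integrable over Q x Q x L, which licenses the exchange of integrals. The double
  integral is then one of a squared mean, whence its nonnegativity; this is where the sign of the
  energy comes from.\<close>

lemma nn_integral_square_mean:
  fixes D :: "'q \<Rightarrow> 'b \<Rightarrow> real"
  assumes "prob_space Q" "sigma_finite_measure L"
    and D[measurable]: "(\<lambda>z. D (fst z) (snd z)) \<in> borel_measurable (Q \<Otimes>\<^sub>M L)"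
    and fin: "(\<integral>\<^sup>+q. \<integral>\<^sup>+l. ennreal ((D q l)\<^sup>2) \<partial>L \<partial>Q) < \<infinity>"
  shows "AE l in L. integrable Q (\<lambda>q. D q l)"
    and "(\<integral>\<^sup>+l. ennreal ((\<integral>q. D q l \<partial>Q)\<^sup>2) \<partial>L)
         = ennreal (\<integral>z. (\<integral>l. D (fst z) l * D (snd z) l \<partial>L) \<partial>(Q \<Otimes>\<^sub>M Q))"
    and "0 \<le> (\<integral>z. (\<integral>l. D (fst z) l * D (snd z) l \<partial>L) \<partial>(Q \<Otimes>\<^sub>M Q))"
proof -
  interpret Q: prob_space Q by fact
  interpret L: sigma_finite_measure L by fact
  interpret QL: pair_sigma_finite Q L ..
  interpret QQ: pair_prob_space Q Q ..
  interpret QQL: pair_sigma_finite "Q \<Otimes>\<^sub>M Q" L ..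
  have D'[measurable]: "(\<lambda>z. D (snd z) (fst z)) \<in> borel_measurable (L \<Otimes>\<^sub>M Q)"
    using measurable_pair_swap[OF D] by (simp add: case_prod_beta')
  have "(\<integral>\<^sup>+l. \<integral>\<^sup>+q. ennreal ((D q l)\<^sup>2) \<partial>Q \<partial>L) < \<infinity>"
    using fin QL.Fubini'[of "\<lambda>q l. ennreal ((D q l)\<^sup>2)"] by (simp add: case_prod_beta')
  then have "AE l in L. (\<integral>\<^sup>+q. ennreal ((D q l)\<^sup>2) \<partial>Q) \<noteq> \<infinity>"
    by (intro nn_integral_PInf_AE Q.borel_measurable_nn_integral)
       (auto simp: less_top[symmetric] case_prod_beta')
  then show int: "AE l in L. integrable Q (\<lambda>q. D q l)"
    using AE_space
  proof eventually_elim
    case (elim l)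
    have [measurable]: "(\<lambda>q. D q l) \<in> borel_measurable Q"
      using measurable_compose[OF measurable_Pair2'[OF elim(2)] D] by simp
    have "integrable Q (\<lambda>q. (D q l)\<^sup>2)"
      using elim by (intro integrableI_nonneg) (auto simp: less_top)
    \<comment> \<open>On a probability space a finite second moment bounds the first.\<close>
    then show ?case by (rule Q.square_integrable_imp_integrable[rotated]) measurable
  qed
  have Dl: "(\<lambda>l. D q l) \<in> borel_measurable L" if "q \<in> space Q" for q
    using measurable_compose[OF measurable_Pair1'[OF that] D] by simp
  let ?F = "\<lambda>w. D (fst (fst w)) (snd w) * D (snd (fst w)) (snd w)"
  let ?S = "\<lambda>q. \<integral>\<^sup>+l. ennreal ((D q l)\<^sup>2) \<partial>L"
  have DF[measurable]: "(\<lambda>w. D (fst (fst w)) (snd w)) \<in> borel_measurable ((Q \<Otimes>\<^sub>M Q) \<Otimes>\<^sub>M L)"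
      "(\<lambda>w. D (snd (fst w)) (snd w)) \<in> borel_measurable ((Q \<Otimes>\<^sub>M Q) \<Otimes>\<^sub>M L)"
  proof -
    have "(\<lambda>w. (fst (fst w), snd w)) \<in> measurable ((Q \<Otimes>\<^sub>M Q) \<Otimes>\<^sub>M L) (Q \<Otimes>\<^sub>M L)"
      "(\<lambda>w. (snd (fst w), snd w)) \<in> measurable ((Q \<Otimes>\<^sub>M Q) \<Otimes>\<^sub>M L) (Q \<Otimes>\<^sub>M L)"
      by measurable
    from this[THEN measurable_compose, OF D]
    show "(\<lambda>w. D (fst (fst w)) (snd w)) \<in> borel_measurable ((Q \<Otimes>\<^sub>M Q) \<Otimes>\<^sub>M L)"
      "(\<lambda>w. D (snd (fst w)) (snd w)) \<in> borel_measurable ((Q \<Otimes>\<^sub>M Q) \<Otimes>\<^sub>M L)"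
      by simp_all
  qed
  have F[measurable]: "?F \<in> borel_measurable ((Q \<Otimes>\<^sub>M Q) \<Otimes>\<^sub>M L)" by measurable
  have S[measurable]: "?S \<in> borel_measurable Q"
    by (rule L.borel_measurable_nn_integral) (simp add: case_prod_beta')
  have F_int: "integrable ((Q \<Otimes>\<^sub>M Q) \<Otimes>\<^sub>M L) ?F"
  proof (rule integrableI_bounded[OF F])
    have "(\<integral>\<^sup>+w. ennreal (norm (?F w)) \<partial>((Q \<Otimes>\<^sub>M Q) \<Otimes>\<^sub>M L))
        \<le> (\<integral>\<^sup>+w. ennreal ((D (fst (fst w)) (snd w))\<^sup>2) + ennreal ((D (snd (fst w)) (snd w))\<^sup>2) \<partial>((Q \<Otimes>\<^sub>M Q) \<Otimes>\<^sub>M L))"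
    proof (intro nn_integral_mono)
      fix w
      have "\<bar>a * b\<bar> \<le> a\<^sup>2 + b\<^sup>2" for a b :: real
      proof -
        have "2 * (\<bar>a\<bar> * \<bar>b\<bar>) \<le> a\<^sup>2 + b\<^sup>2" "0 \<le> \<bar>a\<bar> * \<bar>b\<bar>"
          using sum_squares_bound[of "\<bar>a\<bar>" "\<bar>b\<bar>"] by simp_all
        then show ?thesis unfolding abs_mult by linarith
      qed
      then show "ennreal (norm (?F w)) \<le> ennreal ((D (fst (fst w)) (snd w))\<^sup>2) + ennreal ((D (snd (fst w)) (snd w))\<^sup>2)"
        by (simp flip: ennreal_plus add: ennreal_leI)
    qed
    also have "\<dots> = (\<integral>\<^sup>+z. \<integral>\<^sup>+l. ennreal ((D (fst z) l)\<^sup>2) + ennreal ((D (snd z) l)\<^sup>2) \<partial>L \<partial>(Q \<Otimes>\<^sub>M Q))"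
      by (subst L.nn_integral_fst[symmetric]) simp_all
    also have "\<dots> = (\<integral>\<^sup>+z. ?S (fst z) + ?S (snd z) \<partial>(Q \<Otimes>\<^sub>M Q))"
      by (intro nn_integral_cong nn_integral_add measurable_compose[OF Dl]) (auto simp: space_pair_measure)
    also have "\<dots> = (\<integral>\<^sup>+z. ?S (fst z) \<partial>(Q \<Otimes>\<^sub>M Q)) + (\<integral>\<^sup>+z. ?S (snd z) \<partial>(Q \<Otimes>\<^sub>M Q))"
      by (rule nn_integral_add) measurable
    also have "(\<integral>\<^sup>+z. ?S (fst z) \<partial>(Q \<Otimes>\<^sub>M Q)) = (\<integral>\<^sup>+q. ?S q \<partial>Q)"
      by (subst (2) Q.distr_pair_fst[of Q, symmetric]) (simp add: nn_integral_distr)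
    also have "(\<integral>\<^sup>+z. ?S (snd z) \<partial>(Q \<Otimes>\<^sub>M Q)) = (\<integral>\<^sup>+q. ?S q \<partial>Q)"
      by (subst (2) distr_pair_snd[OF \<open>prob_space Q\<close> \<open>prob_space Q\<close>, symmetric]) (simp add: nn_integral_distr)
    also have "(\<integral>\<^sup>+q. ?S q \<partial>Q) + (\<integral>\<^sup>+q. ?S q \<partial>Q) < \<infinity>" using fin by simp
    finally show "(\<integral>\<^sup>+w. ennreal (norm (?F w)) \<partial>((Q \<Otimes>\<^sub>M Q) \<Otimes>\<^sub>M L)) < \<infinity>" .
  qed
  have sq: "AE l in L. (\<integral>q. D q l \<partial>Q)\<^sup>2 = (\<integral>z. D (fst z) l * D (snd z) l \<partial>(Q \<Otimes>\<^sub>M Q))"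
    using int
  proof eventually_elim
    case (elim l)
    have "(\<integral>z. D (fst z) l * D (snd z) l \<partial>(Q \<Otimes>\<^sub>M Q)) = (\<integral>q. (\<integral>q'. D q l * D q' l \<partial>Q) \<partial>Q)"
    proof (subst QQ.integral_fst'[symmetric])
      show "integrable (Q \<Otimes>\<^sub>M Q) (\<lambda>z. D (fst z) l * D (snd z) l)"
      proof (rule QQ.Fubini_integrable)
        have [measurable]: "(\<lambda>q. D q l) \<in> borel_measurable Q"
          using elim by (rule borel_measurable_integrable)
        show "(\<lambda>z. D (fst z) l * D (snd z) l) \<in> borel_measurable (Q \<Otimes>\<^sub>M Q)" by measurable
        show "integrable Q (\<lambda>q. \<integral>q'. norm (D (fst (q, q')) l * D (snd (q, q')) l) \<partial>Q)"
          using elim by (simp add: abs_mult)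
        show "AE q in Q. integrable Q (\<lambda>q'. D (fst (q, q')) l * D (snd (q, q')) l)"
          using elim by simp
      qed
    qed simp
    then show ?case by (simp add: power2_eq_square)
  qed
  have swap: "integrable (L \<Otimes>\<^sub>M (Q \<Otimes>\<^sub>M Q)) (\<lambda>(l, z). ?F (z, l))"
    using QQL.integrable_product_swap[OF F_int] by simp
  have int_L: "integrable L (\<lambda>l. \<integral>z. D (fst z) l * D (snd z) l \<partial>(Q \<Otimes>\<^sub>M Q))"
    using QQL.integrable_snd[of "\<lambda>z l. ?F (z, l)"] F_int by (simp add: case_prod_beta')
  have nn: "AE l in L. 0 \<le> (\<integral>z. D (fst z) l * D (snd z) l \<partial>(Q \<Otimes>\<^sub>M Q))"
    using sq by eventually_elim (metis zero_le_power2)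
  have Fub: "(\<integral>l. (\<integral>z. D (fst z) l * D (snd z) l \<partial>(Q \<Otimes>\<^sub>M Q)) \<partial>L)
      = (\<integral>z. (\<integral>l. D (fst z) l * D (snd z) l \<partial>L) \<partial>(Q \<Otimes>\<^sub>M Q))"
    using QQL.Fubini_integral[of "\<lambda>z l. ?F (z, l)"] F_int by (simp add: case_prod_beta')
  have "(\<integral>\<^sup>+l. ennreal ((\<integral>q. D q l \<partial>Q)\<^sup>2) \<partial>L) = (\<integral>\<^sup>+l. ennreal (\<integral>z. D (fst z) l * D (snd z) l \<partial>(Q \<Otimes>\<^sub>M Q)) \<partial>L)"
    using sq by (intro nn_integral_cong_AE) auto
  also have "\<dots> = ennreal (\<integral>l. (\<integral>z. D (fst z) l * D (snd z) l \<partial>(Q \<Otimes>\<^sub>M Q)) \<partial>L)"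
    by (rule nn_integral_eq_integral[OF int_L nn])
  finally show "(\<integral>\<^sup>+l. ennreal ((\<integral>q. D q l \<partial>Q)\<^sup>2) \<partial>L)
         = ennreal (\<integral>z. (\<integral>l. D (fst z) l * D (snd z) l \<partial>L) \<partial>(Q \<Otimes>\<^sub>M Q))"
    unfolding Fub .
  show "0 \<le> (\<integral>z. (\<integral>l. D (fst z) l * D (snd z) l \<partial>L) \<partial>(Q \<Otimes>\<^sub>M Q))"
    unfolding Fub[symmetric] by (rule integral_nonneg_AE[OF nn])
qed

text \<open>One coordinate from each of two independent blocks gives a pair with product law. Thus
  kernel terms on a larger product space are evaluated on pairs.\<close>

lemma has_bochner_integral_pair_marginals:
  fixes k :: "'s \<Rightarrow> 't \<Rightarrow> real"
  assumes A: "prob_space A" and B: "prob_space B"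
    and f: "f \<in> measurable A S" and g: "g \<in> measurable B T"
    and S: "distr A S f = S" and T: "distr B T g = T"
    and k: "integrable (S \<Otimes>\<^sub>M T) (\<lambda>z. k (fst z) (snd z))"
  shows "has_bochner_integral (A \<Otimes>\<^sub>M B) (\<lambda>z. k (f (fst z)) (g (snd z))) (\<integral>z. k (fst z) (snd z) \<partial>(S \<Otimes>\<^sub>M T))"
proof -
  have "(\<lambda>z. (f (fst z), g (snd z))) \<in> measurable (A \<Otimes>\<^sub>M B) (S \<Otimes>\<^sub>M T)"
    by (rule measurable_Pair[OF measurable_compose[OF measurable_fst f] measurable_compose[OF measurable_snd g]])
  from has_bochner_integral_distr_eq[OF distr_pair_marginals[OF A B f g S T] this k]
  show ?thesis by simp
qed

text \<open>The energy identity for any kernel \<open>k\<close> that is the squared distance of a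
  family \<open>g\<close> whose increments are square integrable; powers of the norm enter only
  through \<open>k\<close>. \<open>E\<close> is the energy for \<open>k\<close>, and it is
  nonnegative because it is a multiple of an integral of squares.\<close>

lemma nn_integral_square_mean_diff:
  fixes \<mu> \<nu> :: "'a measure" and L :: "'b measure" and g :: "'a \<Rightarrow> 'b \<Rightarrow> real" and k :: "'a \<Rightarrow> 'a \<Rightarrow> real"
  assumes mu: "prob_space \<mu>" and nu: "prob_space \<nu>" and sets_nu: "sets \<nu> = sets \<mu>" and L: "sigma_finite_measure L"
    and g[measurable]: "(\<lambda>z. g (fst z) (snd z)) \<in> borel_measurable (\<mu> \<Otimes>\<^sub>M L)"
    and k: "\<And>x y. x \<in> space \<mu> \<Longrightarrow> y \<in> space \<mu> \<Longrightarrow> (\<integral>\<^sup>+l. ennreal ((g x l - g y l)\<^sup>2) \<partial>L) = ennreal (k x y)"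
    and k_nonneg: "\<And>x y. 0 \<le> k x y" and k_sym: "\<And>x y. k x y = k y x"
    and int_mn: "integrable (\<mu> \<Otimes>\<^sub>M \<nu>) (\<lambda>z. k (fst z) (snd z))"
    and int_mm: "integrable (\<mu> \<Otimes>\<^sub>M \<mu>) (\<lambda>z. k (fst z) (snd z))"
    and int_nn: "integrable (\<nu> \<Otimes>\<^sub>M \<nu>) (\<lambda>z. k (fst z) (snd z))"
  defines "E \<equiv> 2 * (\<integral>z. k (fst z) (snd z) \<partial>(\<mu> \<Otimes>\<^sub>M \<nu>)) - (\<integral>z. k (fst z) (snd z) \<partial>(\<mu> \<Otimes>\<^sub>M \<mu>))
      - (\<integral>z. k (fst z) (snd z) \<partial>(\<nu> \<Otimes>\<^sub>M \<nu>))"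
  shows "(\<integral>\<^sup>+l. ennreal (((\<integral>x. g x l \<partial>\<mu>) - (\<integral>y. g y l \<partial>\<nu>))\<^sup>2) \<partial>L) = ennreal (E / 2)" and "0 \<le> E"
proof -
  interpret M: prob_space \<mu> by fact
  interpret N: prob_space \<nu> by fact
  interpret L: sigma_finite_measure L by fact
  interpret MN: pair_prob_space \<mu> \<nu> ..
  define Q where "Q = \<mu> \<Otimes>\<^sub>M \<nu>"
  have Q: "prob_space Q" unfolding Q_def by unfold_locales
  define D where "D q l = g (fst q) l - g (snd q) l" for q l
  have sp: "space \<nu> = space \<mu>" using sets_nu by (rule sets_eq_imp_space_eq)
  have spQ: "fst q \<in> space \<mu>" "snd q \<in> space \<mu>" if "q \<in> space Q" for q
    using that by (auto simp: Q_def space_pair_measure sp)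
  have fst_Q[measurable]: "fst \<in> measurable Q \<mu>" and snd_Q[measurable]: "snd \<in> measurable Q \<nu>"
    unfolding Q_def by measurable
  \<comment> \<open>\<open>g\<close> is measurable with respect to \<mu>, but is also evaluated at
    the second coordinate, which has law \<nu>.\<close>
  have snd_Q'[measurable]: "snd \<in> measurable Q \<mu>"
    using snd_Q by (simp cong: measurable_cong_sets add: sets_nu)
  have D_meas: "(\<lambda>z. D (fst z) (snd z)) \<in> borel_measurable (Q \<Otimes>\<^sub>M L)"
  proof -
    have "(\<lambda>z. (fst (fst z), snd z)) \<in> measurable (Q \<Otimes>\<^sub>M L) (\<mu> \<Otimes>\<^sub>M L)"
      "(\<lambda>z. (snd (fst z), snd z)) \<in> measurable (Q \<Otimes>\<^sub>M L) (\<mu> \<Otimes>\<^sub>M L)"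
      by measurable
    from this[THEN measurable_compose, OF g] show ?thesis
      unfolding D_def by (intro borel_measurable_diff) simp_all
  qed
  have gl: "(\<lambda>l. g x l) \<in> borel_measurable L" if "x \<in> space \<mu>" for x
    using measurable_compose[OF measurable_Pair1'[OF that] g] by simp
  have hb: "has_bochner_integral L (\<lambda>l. (g x l - g y l)\<^sup>2) (k x y)" if "x \<in> space \<mu>" "y \<in> space \<mu>" for x y
    using that gl[OF that(1)] gl[OF that(2)] k k_nonneg by (intro has_bochner_integral_nn_integral) auto
  have "(\<integral>\<^sup>+q. \<integral>\<^sup>+l. ennreal ((D q l)\<^sup>2) \<partial>L \<partial>Q) = (\<integral>\<^sup>+q. ennreal (k (fst q) (snd q)) \<partial>Q)"
    unfolding D_def by (intro nn_integral_cong k spQ)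
  also have "\<dots> < \<infinity>"
    using int_mn k_nonneg unfolding Q_def by (simp add: integrable_iff_bounded)
  finally have fin: "(\<integral>\<^sup>+q. \<integral>\<^sup>+l. ennreal ((D q l)\<^sup>2) \<partial>L \<partial>Q) < \<infinity>" .
  note main = nn_integral_square_mean[OF Q L D_meas fin]
  have "AE l in L. (\<integral>q. D q l \<partial>Q) = (\<integral>x. g x l \<partial>\<mu>) - (\<integral>y. g y l \<partial>\<nu>)"
    using main(1) unfolding D_def Q_def
    by eventually_elim (rule integrable_pair_diff(3)[OF mu nu])
  then have "(\<integral>\<^sup>+l. ennreal (((\<integral>x. g x l \<partial>\<mu>) - (\<integral>y. g y l \<partial>\<nu>))\<^sup>2) \<partial>L) = (\<integral>\<^sup>+l. ennreal ((\<integral>q. D q l \<partial>Q)\<^sup>2) \<partial>L)"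
    by (intro nn_integral_cong_AE) auto
  also note main(2)
  \<comment> \<open>The half is that of the polarization identity. Its two positive terms pair an X
    with a Y, in both orders, and by symmetry of \<open>k\<close> add up to the doubled mixed
    integral of \<open>E\<close>.\<close>
  also have E_eq: "(\<integral>z. (\<integral>l. D (fst z) l * D (snd z) l \<partial>L) \<partial>(Q \<Otimes>\<^sub>M Q)) = E / 2"
  proof -
    have inner: "(\<integral>l. D (fst z) l * D (snd z) l \<partial>L)
        = (k (fst (fst z)) (snd (snd z)) + k (snd (fst z)) (fst (snd z))
           - k (fst (fst z)) (fst (snd z)) - k (snd (fst z)) (snd (snd z))) / 2"
      if z: "z \<in> space (Q \<Otimes>\<^sub>M Q)" for z
    proof -
      obtain q q' where z_eq: "z = (q, q')" "q \<in> space Q" "q' \<in> space Q"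
        using z by (auto simp: space_pair_measure)
      have eq: "D q l * D q' l = ((g (fst q) l - g (snd q') l)\<^sup>2 + (g (snd q) l - g (fst q') l)\<^sup>2
          - (g (fst q) l - g (fst q') l)\<^sup>2 - (g (snd q) l - g (snd q') l)\<^sup>2) / 2" for l
        unfolding D_def by (simp add: power2_eq_square algebra_simps)
      have "has_bochner_integral L (\<lambda>l. ((g (fst q) l - g (snd q') l)\<^sup>2 + (g (snd q) l - g (fst q') l)\<^sup>2
          - (g (fst q) l - g (fst q') l)\<^sup>2 - (g (snd q) l - g (snd q') l)\<^sup>2) / 2)
          ((k (fst q) (snd q') + k (snd q) (fst q') - k (fst q) (fst q') - k (snd q) (snd q')) / 2)"
        using spQ[OF z_eq(2)] spQ[OF z_eq(3)]
        by (intro has_bochner_integral_divide_zero has_bochner_integral_diff has_bochner_integral_add hb)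
      then show ?thesis
        unfolding z_eq(1) fst_conv snd_conv eq by (rule has_bochner_integral_integral_eq)
    qed
    have dfst: "distr Q \<mu> fst = \<mu>" unfolding Q_def by (rule N.distr_pair_fst)
    have dsnd: "distr Q \<nu> snd = \<nu>" unfolding Q_def by (rule distr_pair_snd[OF mu nu])
    have int_nm: "integrable (\<nu> \<Otimes>\<^sub>M \<mu>) (\<lambda>z. k (fst z) (snd z))"
      using MN.integrable_product_swap[OF int_mn] by (simp add: case_prod_beta' k_sym)
    have val_nm: "(\<integral>z. k (fst z) (snd z) \<partial>(\<nu> \<Otimes>\<^sub>M \<mu>)) = (\<integral>z. k (fst z) (snd z) \<partial>(\<mu> \<Otimes>\<^sub>M \<nu>))"
      using MN.integral_product_swap[of "\<lambda>z. k (fst z) (snd z)"] int_mn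
      by (simp add: case_prod_beta' k_sym borel_measurable_integrable)
    note marg = has_bochner_integral_pair_marginals[OF Q Q]
    have "has_bochner_integral (Q \<Otimes>\<^sub>M Q) (\<lambda>z. (k (fst (fst z)) (snd (snd z)) + k (snd (fst z)) (fst (snd z))
           - k (fst (fst z)) (fst (snd z)) - k (snd (fst z)) (snd (snd z))) / 2) (E / 2)"
    proof -
      have "E = (\<integral>z. k (fst z) (snd z) \<partial>(\<mu> \<Otimes>\<^sub>M \<nu>)) + (\<integral>z. k (fst z) (snd z) \<partial>(\<nu> \<Otimes>\<^sub>M \<mu>))
          - (\<integral>z. k (fst z) (snd z) \<partial>(\<mu> \<Otimes>\<^sub>M \<mu>)) - (\<integral>z. k (fst z) (snd z) \<partial>(\<nu> \<Otimes>\<^sub>M \<nu>))"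
        unfolding E_def val_nm by simp
      moreover have "has_bochner_integral (Q \<Otimes>\<^sub>M Q) (\<lambda>z. k (fst (fst z)) (snd (snd z))) (\<integral>z. k (fst z) (snd z) \<partial>(\<mu> \<Otimes>\<^sub>M \<nu>))"
        by (rule marg[OF fst_Q snd_Q dfst dsnd int_mn])
      moreover have "has_bochner_integral (Q \<Otimes>\<^sub>M Q) (\<lambda>z. k (snd (fst z)) (fst (snd z))) (\<integral>z. k (fst z) (snd z) \<partial>(\<nu> \<Otimes>\<^sub>M \<mu>))"
        by (rule marg[OF snd_Q fst_Q dsnd dfst int_nm])
      moreover have "has_bochner_integral (Q \<Otimes>\<^sub>M Q) (\<lambda>z. k (fst (fst z)) (fst (snd z))) (\<integral>z. k (fst z) (snd z) \<partial>(\<mu> \<Otimes>\<^sub>M \<mu>))"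
        by (rule marg[OF fst_Q fst_Q dfst dfst int_mm])
      moreover have "has_bochner_integral (Q \<Otimes>\<^sub>M Q) (\<lambda>z. k (snd (fst z)) (snd (snd z))) (\<integral>z. k (fst z) (snd z) \<partial>(\<nu> \<Otimes>\<^sub>M \<nu>))"
        by (rule marg[OF snd_Q snd_Q dsnd dsnd int_nn])
      ultimately show ?thesis
        by (simp only:) (intro has_bochner_integral_divide_zero has_bochner_integral_diff has_bochner_integral_add)
    qed
    then have "(\<integral>z. (k (fst (fst z)) (snd (snd z)) + k (snd (fst z)) (fst (snd z))
           - k (fst (fst z)) (fst (snd z)) - k (snd (fst z)) (snd (snd z))) / 2 \<partial>(Q \<Otimes>\<^sub>M Q)) = E / 2"
      by (rule has_bochner_integral_integral_eq)
    then show ?thesis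
      by (subst Bochner_Integration.integral_cong[OF refl inner])
  qed
  finally show "(\<integral>\<^sup>+l. ennreal (((\<integral>x. g x l \<partial>\<mu>) - (\<integral>y. g y l \<partial>\<nu>))\<^sup>2) \<partial>L) = ennreal (E / 2)" .
  show "0 \<le> E" using main(3) unfolding E_eq by simp
qed

section \<open>The energy as integrals over pairs, and their convergence\<close>

text \<open>Each summand involves two independent coordinates only. Separate integrability is what
  permits splitting the Bochner integral of the sum.\<close>

lemma integral_energy_product:
  fixes \<mu> \<nu> :: "'a measure" and k :: "'a \<Rightarrow> 'a \<Rightarrow> real"
  assumes mu: "prob_space \<mu>" and nu: "prob_space \<nu>"
    and int_mn: "integrable (\<mu> \<Otimes>\<^sub>M \<nu>) (\<lambda>z. k (fst z) (snd z))"
    and int_mm: "integrable (\<mu> \<Otimes>\<^sub>M \<mu>) (\<lambda>z. k (fst z) (snd z))"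
    and int_nn: "integrable (\<nu> \<Otimes>\<^sub>M \<nu>) (\<lambda>z. k (fst z) (snd z))"
  shows "(\<integral>(x, x', y, y'). 2 * k x y - k x x' - k y y' \<partial>(\<mu> \<Otimes>\<^sub>M \<mu> \<Otimes>\<^sub>M \<nu> \<Otimes>\<^sub>M \<nu>))
    = 2 * (\<integral>z. k (fst z) (snd z) \<partial>(\<mu> \<Otimes>\<^sub>M \<nu>)) - (\<integral>z. k (fst z) (snd z) \<partial>(\<mu> \<Otimes>\<^sub>M \<mu>))
      - (\<integral>z. k (fst z) (snd z) \<partial>(\<nu> \<Otimes>\<^sub>M \<nu>))"
proof -
  interpret M: prob_space \<mu> by fact
  interpret N: prob_space \<nu> by fact
  interpret NN: pair_prob_space \<nu> \<nu> ..
  interpret MNN: pair_prob_space \<mu> "\<nu> \<Otimes>\<^sub>M \<nu>" ..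
  let ?R = "\<mu> \<Otimes>\<^sub>M \<nu> \<Otimes>\<^sub>M \<nu>"
  let ?P = "\<mu> \<Otimes>\<^sub>M ?R"
  have NN: "prob_space (\<nu> \<Otimes>\<^sub>M \<nu>)" and R: "prob_space ?R" by unfold_locales
  interpret R: prob_space ?R by (rule R)
  have id: "distr \<mu> \<mu> (\<lambda>x. x) = \<mu>" by (rule distr_id)
  have R1: "distr ?R \<mu> fst = \<mu>" by (rule NN.distr_pair_fst)
  have R2: "distr ?R (\<nu> \<Otimes>\<^sub>M \<nu>) snd = \<nu> \<Otimes>\<^sub>M \<nu>" by (rule distr_pair_snd[OF mu NN])
  have R3: "distr ?R \<nu> (\<lambda>r. fst (snd r)) = \<nu>"
  proof -
    have "distr ?R \<nu> (\<lambda>r. fst (snd r)) = distr (distr ?R (\<nu> \<Otimes>\<^sub>M \<nu>) snd) \<nu> fst"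
      by (subst distr_distr) (auto simp: comp_def)
    then show ?thesis by (simp add: R2 N.distr_pair_fst)
  qed
  have P2: "distr ?P (\<nu> \<Otimes>\<^sub>M \<nu>) (\<lambda>z. snd (snd z)) = \<nu> \<Otimes>\<^sub>M \<nu>"
  proof -
    have "distr ?P (\<nu> \<Otimes>\<^sub>M \<nu>) (\<lambda>z. snd (snd z)) = distr (distr ?P ?R snd) (\<nu> \<Otimes>\<^sub>M \<nu>) snd"
      by (subst distr_distr) (auto simp: comp_def)
    then show ?thesis by (simp add: R2 distr_pair_snd[OF mu R])
  qed
  have "has_bochner_integral ?P (\<lambda>z. k (fst z) (fst (snd (snd z)))) (\<integral>z. k (fst z) (snd z) \<partial>(\<mu> \<Otimes>\<^sub>M \<nu>))"
    by (rule has_bochner_integral_pair_marginals[OF mu R _ _ id R3 int_mn]) measurable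
  moreover have "has_bochner_integral ?P (\<lambda>z. k (fst z) (fst (snd z))) (\<integral>z. k (fst z) (snd z) \<partial>(\<mu> \<Otimes>\<^sub>M \<mu>))"
    by (rule has_bochner_integral_pair_marginals[OF mu R _ _ id R1 int_mm]) measurable
  moreover have "has_bochner_integral ?P (\<lambda>z. k (fst (snd (snd z))) (snd (snd (snd z)))) (\<integral>z. k (fst z) (snd z) \<partial>(\<nu> \<Otimes>\<^sub>M \<nu>))"
    using has_bochner_integral_distr_eq[OF P2 _ int_nn] by simp
  ultimately have "has_bochner_integral ?P (\<lambda>z. 2 * k (fst z) (fst (snd (snd z))) - k (fst z) (fst (snd z)) - k (fst (snd (snd z))) (snd (snd (snd z))))
    (2 * (\<integral>z. k (fst z) (snd z) \<partial>(\<mu> \<Otimes>\<^sub>M \<nu>)) - (\<integral>z. k (fst z) (snd z) \<partial>(\<mu> \<Otimes>\<^sub>M \<mu>))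
      - (\<integral>z. k (fst z) (snd z) \<partial>(\<nu> \<Otimes>\<^sub>M \<nu>)))"
    by (intro has_bochner_integral_diff has_bochner_integral_mult_right) auto
  from has_bochner_integral_integral_eq[OF this] show ?thesis
    by (simp add: case_prod_beta')
qed

lemma integrable_norm_diff_powr:
  fixes \<mu> \<nu> :: "'a::euclidean_space measure"
  assumes \<gamma>: "0 < \<gamma>" and mu: "prob_space \<mu>" and nu: "prob_space \<nu>"
    and sets[measurable_cong]: "sets \<mu> = sets borel" "sets \<nu> = sets borel"
    and int: "integrable \<mu> (\<lambda>x. norm x powr \<gamma>)" "integrable \<nu> (\<lambda>x. norm x powr \<gamma>)"
  shows "integrable (\<mu> \<Otimes>\<^sub>M \<nu>) (\<lambda>z. norm (fst z - snd z) powr \<gamma>)"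
proof (rule Bochner_Integration.integrable_bound)
  interpret N: prob_space \<nu> by fact
  have "integrable (\<mu> \<Otimes>\<^sub>M \<nu>) (\<lambda>z. norm (fst z) powr \<gamma>)" "integrable (\<mu> \<Otimes>\<^sub>M \<nu>) (\<lambda>z. norm (snd z) powr \<gamma>)"
    using has_bochner_integral_distr_eq[OF N.distr_pair_fst[of \<mu>] _ int(1)]
      has_bochner_integral_distr_eq[OF distr_pair_snd[OF mu nu] _ int(2)]
    by (auto simp: has_bochner_integral_iff)
  then show "integrable (\<mu> \<Otimes>\<^sub>M \<nu>) (\<lambda>z. 2 powr \<gamma> * (norm (fst z) powr \<gamma> + norm (snd z) powr \<gamma>))"
    by (intro integrable_mult_right Bochner_Integration.integrable_add)
  show "(\<lambda>z. norm (fst z - snd z) powr \<gamma>) \<in> borel_measurable (\<mu> \<Otimes>\<^sub>M \<nu>)" by measurable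
  \<comment> \<open>Passing through twice the maximum of the norms treats concave (\<gamma> \<le> 1)
    and convex (\<gamma> \<ge> 1) powers alike.\<close>
  have "norm (x - y) powr \<gamma> \<le> 2 powr \<gamma> * (norm x powr \<gamma> + norm y powr \<gamma>)" for x y :: 'a
  proof -
    have "norm (x - y) powr \<gamma> \<le> (2 * max (norm x) (norm y)) powr \<gamma>"
      using \<gamma> norm_triangle_ineq4[of x y] by (intro powr_mono2) auto
    also have "\<dots> = 2 powr \<gamma> * max (norm x) (norm y) powr \<gamma>"
      by (simp add: powr_mult)
    also have "\<dots> \<le> 2 powr \<gamma> * (norm x powr \<gamma> + norm y powr \<gamma>)"
      by (intro mult_left_mono) (auto simp: max_def)
    finally show ?thesis .
  qed
  then show "AE z in \<mu> \<Otimes>\<^sub>M \<nu>. norm (norm (fst z - snd z) powr \<gamma>) \<le> norm (2 powr \<gamma> * (norm (fst z) powr \<gamma> + norm (snd z) powr \<gamma>))"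
    by simp
qed

section \<open>The normalizing constant\<close>

lemma Gamma_duplication_real:
  fixes z :: real
  assumes z: "0 < z"
  shows "Gamma z * Gamma (z + 1 / 2) = 2 powr (1 - 2 * z) * sqrt pi * Gamma (2 * z)"
proof -
  have "complex_of_real z \<notin> \<int>\<^sub>\<le>\<^sub>0" "complex_of_real z + 1 / 2 \<notin> \<int>\<^sub>\<le>\<^sub>0"
  proof -
    have "z \<notin> \<int>\<^sub>\<le>\<^sub>0" "z + 1 / 2 \<notin> \<int>\<^sub>\<le>\<^sub>0" using z by (auto dest: nonpos_Ints_nonpos)
    then have "complex_of_real z \<notin> \<int>\<^sub>\<le>\<^sub>0" "complex_of_real (z + 1 / 2) \<notin> \<int>\<^sub>\<le>\<^sub>0"
      unfolding of_real_in_nonpos_Ints_iff by blast+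
    then show "complex_of_real z \<notin> \<int>\<^sub>\<le>\<^sub>0" "complex_of_real z + 1 / 2 \<notin> \<int>\<^sub>\<le>\<^sub>0" by simp_all
  qed
  note dup = Gamma_legendre_duplication[OF this]
  have "complex_of_real (Gamma z * Gamma (z + 1 / 2)) = Gamma (of_real z) * Gamma (of_real z + 1 / 2)"
    by (simp flip: Gamma_complex_of_real)
  also have "\<dots> = of_real (exp ((1 - 2 * z) * ln 2) * sqrt pi * Gamma (2 * z))"
  proof -
    have "exp ((1 - 2 * complex_of_real z) * of_real (ln 2)) = of_real (exp ((1 - 2 * z) * ln 2))"
      by (subst exp_of_real[symmetric]) simp
    moreover have "Gamma (2 * complex_of_real z) = of_real (Gamma (2 * z))"
      by (simp flip: Gamma_complex_of_real)
    ultimately show ?thesis unfolding dup by simp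
  qed
  finally have "Gamma z * Gamma (z + 1 / 2) = exp ((1 - 2 * z) * ln 2) * sqrt pi * Gamma (2 * z)"
    by (simp only: of_real_eq_iff)
  then show ?thesis by (simp add: powr_def)
qed

text \<open>Special values are replaced by variables. In the application a, h, g, t, G, Gd are
  \<open>Gamma\<close> at (\<gamma> + 1)/2, (1 - \<gamma>)/2, \<gamma>/2, 1 - \<gamma>/2, \<gamma>,
  (d + \<gamma>)/2; C and sn are cosine and sine of pi (\<gamma> - 1)/2, and q is the cosine of half
  that angle; w = 2^(\<gamma>-1), r = sqrt pi, p = pi^((d-1)/2). Then \<open>e1\<close> and
  \<open>e3\<close> are reflection, \<open>e2\<close> the double angle, \<open>e4\<close>
  duplication.\<close>

lemma S_const_algebra:
  fixes a h q C sn g t w G r p Gd \<gamma> :: real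
  assumes nz: "a \<noteq> 0" "h \<noteq> 0" "q \<noteq> 0" "C \<noteq> 0" "g \<noteq> 0" "w \<noteq> 0" "G \<noteq> 0" "Gd \<noteq> 0" "\<gamma> \<noteq> 0"
    and e1: "h * a * sn = - pi" and e2: "sn\<^sup>2 = 2 * (1 - C) * q\<^sup>2"
    and e3: "g * t * C = pi" and e4: "g * a * w = r * G"
  shows "p * pi * r * t / (\<gamma> * w * Gd * q\<^sup>2 * h\<^sup>2) = 2 * (1 / C - 1) * a\<^sup>2 / (\<gamma> * G) * (2 * p * a / Gd) / 2"
proof -
  have sq: "2 * (1 - C) * q\<^sup>2 * h\<^sup>2 * a\<^sup>2 = pi\<^sup>2"
  proof -
    have "(h * a * sn)\<^sup>2 = pi\<^sup>2" unfolding e1 by simp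
    then show ?thesis unfolding power_mult_distrib e2 by (simp only: mult_ac)
  qed
  have "g * (pi * r * t * C * G) = pi * (g * t * C) * (r * G)" by (simp only: mult_ac)
  also have "\<dots> = pi\<^sup>2 * (g * a * w)" unfolding e3 e4 by (simp only: power2_eq_square)
  also have "\<dots> = g * (2 * (1 - C) * a ^ 3 * (w * q\<^sup>2 * h\<^sup>2))"
    unfolding sq[symmetric] by (simp add: power2_eq_square power3_eq_cube)
  finally have N: "pi * r * t * C * G = 2 * (1 - C) * a ^ 3 * (w * q\<^sup>2 * h\<^sup>2)"
    using nz(5) by (simp only: mult_cancel_left) auto
  have "p * pi * r * t / (\<gamma> * w * Gd * q\<^sup>2 * h\<^sup>2)
      = p * (pi * r * t * C * G) / (\<gamma> * w * Gd * q\<^sup>2 * h\<^sup>2 * C * G)"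
    using nz by (simp add: mult_ac)
  also have "\<dots> = p * (2 * (1 - C) * a ^ 3) * (w * q\<^sup>2 * h\<^sup>2) / ((\<gamma> * Gd * C * G) * (w * q\<^sup>2 * h\<^sup>2))"
    unfolding N by (simp only: mult_ac)
  also have "\<dots> = p * (2 * (1 - C) * a ^ 3) / (\<gamma> * Gd * C * G)"
    using nz by (intro mult_divide_mult_cancel_right) simp
  also have "\<dots> = 2 * (1 / C - 1) * a\<^sup>2 / (\<gamma> * G) * (2 * p * a / Gd) / 2"
  proof -
    have "1 / C - 1 = (1 - C) / C" using nz by (simp add: diff_divide_distrib)
    then show ?thesis using nz by (simp add: power2_eq_square power3_eq_cube field_simps)
  qed
  finally show ?thesis .
qed

text \<open>The square of the cosine in \<open>S_const\<close> stems from sin^2 (2x) = 2 (1 - cos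
  (2x)) cos^2 x, which absorbs the factor 1 - cos (pi s) of \<open>psi_const\<close>; the squared
  \<open>Gamma\<close> is its reflection partner.\<close>

lemma S_const_eq:
  assumes \<gamma>: "0 < \<gamma>" "\<gamma> < 2" and d: "0 < d"
  shows "S_const d \<gamma> = psi_const \<gamma> * sphere_moment d \<gamma> / 2"
proof (cases "\<gamma> = 1")
  case True
  then show ?thesis by (simp add: S_const_def psi_const_def sphere_moment_def)
next
  case False
  define s where "s = (\<gamma> - 1) / 2"
  have s: "- 1/2 < s" "s < 1/2" "s \<noteq> 0" and \<gamma>_eq: "\<gamma> = 2 * s + 1"
    using \<gamma> False by (auto simp: s_def field_simps)
  let ?a = "Gamma ((\<gamma> + 1) / 2)"
  let ?h = "Gamma ((1 - \<gamma>) / 2)"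
  let ?q = "cos (pi * (\<gamma> - 1) / 4)"
  let ?C = "cos (pi * (\<gamma> - 1) / 2)"
  let ?sn = "sin (pi * (\<gamma> - 1) / 2)"
  let ?p = "pi powr ((real d - 1) / 2)"
  have bounds: "- (pi / 2) < pi * (\<gamma> - 1) / 2" "pi * (\<gamma> - 1) / 2 < pi / 2"
  proof -
    have "pi * (- 1) < pi * (\<gamma> - 1)" "pi * (\<gamma> - 1) < pi * 1"
      using \<gamma> by (intro mult_strict_left_mono pi_gt_zero; simp)+
    then show "- (pi / 2) < pi * (\<gamma> - 1) / 2" "pi * (\<gamma> - 1) / 2 < pi / 2" by simp_all
  qed
  have C: "?C \<noteq> 0" using cos_gt_zero_pi[OF bounds] by linarith
  have q: "?q \<noteq> 0"
  proof -
    have "- (pi / 2) < pi * (\<gamma> - 1) / 4" "pi * (\<gamma> - 1) / 4 < pi / 2"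
      using bounds pi_gt_zero by linarith+
    from cos_gt_zero_pi[OF this] show ?thesis by linarith
  qed
  have sn: "?sn \<noteq> 0"
  proof
    assume "?sn = 0"
    moreover have "- pi < pi * (\<gamma> - 1) / 2" "pi * (\<gamma> - 1) / 2 < pi"
      using bounds pi_gt_zero by linarith+
    ultimately have "pi * (\<gamma> - 1) / 2 = 0" using sin_eq_0_pi[of "pi * (\<gamma> - 1) / 2"] by metis
    with False show False by simp
  qed
  have e1: "?h * ?a * ?sn = - pi"
  proof -
    have "1 - (1 - \<gamma>) / 2 = (\<gamma> + 1) / 2" by (simp add: field_simps)
    moreover have "sin (pi * ((1 - \<gamma>) / 2)) = - ?sn"
    proof -
      have "pi * ((1 - \<gamma>) / 2) = - (pi * (\<gamma> - 1) / 2)" by (simp add: field_simps)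
      then show ?thesis by (simp only: sin_minus)
    qed
    ultimately have "?h * ?a = pi / (- ?sn)"
      using Gamma_reflection_real[of "(1 - \<gamma>) / 2"] by (simp only:)
    then show ?thesis using sn by simp
  qed
  have e2: "?sn\<^sup>2 = 2 * (1 - ?C) * ?q\<^sup>2"
  proof -
    have h: "pi * (\<gamma> - 1) / 2 = 2 * (pi * (\<gamma> - 1) / 4)" by simp
    have "?sn\<^sup>2 = 4 * (sin (pi * (\<gamma> - 1) / 4))\<^sup>2 * ?q\<^sup>2"
      unfolding h sin_double by (simp add: power_mult_distrib)
    moreover have "1 - ?C = 2 * (sin (pi * (\<gamma> - 1) / 4))\<^sup>2"
      unfolding h cos_double_sin by simp
    ultimately show ?thesis by (simp only: mult.assoc[symmetric])
  qed
  have e3: "Gamma (\<gamma> / 2) * Gamma (1 - \<gamma> / 2) * ?C = pi"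
  proof -
    have "sin (pi * (\<gamma> / 2)) = ?C"
    proof -
      have "pi * (\<gamma> / 2) = pi * (\<gamma> - 1) / 2 + pi / 2" by (simp add: field_simps)
      then have "sin (pi * (\<gamma> / 2)) = sin (pi * (\<gamma> - 1) / 2 + pi / 2)" by (rule arg_cong)
      then show ?thesis by (simp add: sin_add)
    qed
    then show ?thesis using Gamma_reflection_real[of "\<gamma> / 2"] C by simp
  qed
  have e4: "Gamma (\<gamma> / 2) * ?a * 2 powr (\<gamma> - 1) = sqrt pi * Gamma \<gamma>"
  proof -
    have "Gamma (\<gamma> / 2) * ?a = 2 powr (1 - \<gamma>) * sqrt pi * Gamma \<gamma>"
      using Gamma_duplication_real[of "\<gamma> / 2"] \<gamma> by (simp add: add_divide_distrib)
    moreover have "2 powr (1 - \<gamma>) * 2 powr (\<gamma> - 1) = (1::real)"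
      by (simp flip: powr_add)
    ultimately show ?thesis by (simp add: mult_ac)
  qed
  have a: "0 < ?a" "0 < Gamma (\<gamma> / 2)" "0 < Gamma \<gamma>" "0 < Gamma ((real d + \<gamma>) / 2)"
    by (rule Gamma_real_pos; use \<gamma> d in simp)+
  then have ne: "?a \<noteq> 0" "Gamma (\<gamma> / 2) \<noteq> 0" "Gamma \<gamma> \<noteq> 0" "Gamma ((real d + \<gamma>) / 2) \<noteq> 0"
    by linarith+
  have "?h \<noteq> 0" using e1 by auto
  have g1: "Gamma (\<gamma> + 1) = \<gamma> * Gamma \<gamma>" using \<gamma>(1) by (rule Gamma_plus1_pos)
  have p1: "pi powr (real d / 2 + 1) = ?p * pi * sqrt pi"
  proof -
    have "?p * pi * sqrt pi = pi powr ((real d - 1) / 2) * pi powr 1 * pi powr (1 / 2)"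
      by (simp add: powr_half_sqrt)
    also have "\<dots> = pi powr (real d / 2 + 1)"
      by (simp only: powr_add[symmetric]) (simp add: field_simps)
    finally show ?thesis ..
  qed
  have "S_const d \<gamma> = ?p * pi * sqrt pi * Gamma (1 - \<gamma> / 2)
      / (\<gamma> * 2 powr (\<gamma> - 1) * Gamma ((real d + \<gamma>) / 2) * ?q\<^sup>2 * ?h\<^sup>2)"
    using False unfolding S_const_def p1 by (simp only: if_False)
  also have "\<dots> = 2 * (1 / ?C - 1) * ?a\<^sup>2 / (\<gamma> * Gamma \<gamma>) * (2 * ?p * ?a / Gamma ((real d + \<gamma>) / 2)) / 2"
    using ne C q \<open>?h \<noteq> 0\<close> \<gamma> by (intro S_const_algebra[OF _ _ _ _ _ _ _ _ _ e1 e2 e3 e4]) simp_all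
  also have "\<dots> = psi_const \<gamma> * sphere_moment d \<gamma> / 2"
    using False unfolding psi_const_def sphere_moment_def g1 by (simp only: if_False)
  finally show ?thesis .
qed

text \<open>For \<gamma> > 1 the value \<open>Gamma ((1 - \<gamma>) / 2)\<close> is negative, but it
  enters squared; only a pole must be ruled out, and \<gamma> \<noteq> 1 keeps the argument away
  from 0.\<close>

lemma S_const_pos:
  assumes "0 < \<gamma>" "\<gamma> < 2" "0 < d"
  shows "0 < S_const d \<gamma>"
proof (cases "\<gamma> = 1")
  case True
  then show ?thesis using assms by (simp add: S_const_def Gamma_real_pos)
next
  case False
  have "(1 - \<gamma>) / 2 \<notin> \<int>\<^sub>\<le>\<^sub>0"
  proof
    assume "(1 - \<gamma>) / 2 \<in> \<int>\<^sub>\<le>\<^sub>0"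
    then obtain n where n: "(1 - \<gamma>) / 2 = of_int n" by (auto elim: nonpos_Ints_cases)
    have "- 1 < real_of_int n" "real_of_int n < 1"
      unfolding n[symmetric] using assms by (simp_all add: field_simps)
    then have "n = 0" by linarith
    with n False show False by simp
  qed
  then have h: "Gamma ((1 - \<gamma>) / 2) \<noteq> 0" by (simp add: Gamma_eq_zero_iff)
  have "pi * (- 1) < pi * (\<gamma> - 1)" "pi * (\<gamma> - 1) < pi * 1"
    using assms by (intro mult_strict_left_mono pi_gt_zero; simp)+
  then have "- (pi / 2) < pi * (\<gamma> - 1) / 4" "pi * (\<gamma> - 1) / 4 < pi / 2"
    using pi_gt_zero by linarith+
  then have q: "cos (pi * (\<gamma> - 1) / 4) \<noteq> 0"
    using cos_gt_zero_pi[of "pi * (\<gamma> - 1) / 4"] by linarith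
  have "0 < Gamma (1 - \<gamma> / 2)" "0 < Gamma ((real d + \<gamma>) / 2)"
    by (rule Gamma_real_pos; use assms in simp)+
  then have "0 < pi powr (real d / 2 + 1) * Gamma (1 - \<gamma> / 2) /
             (\<gamma> * 2 powr (\<gamma> - 1) * Gamma ((real d + \<gamma>) / 2) *
              (cos (pi * (\<gamma> - 1) / 4))\<^sup>2 * (Gamma ((1 - \<gamma>) / 2))\<^sup>2)"
    using assms h q by (intro divide_pos_pos mult_pos_pos) simp_all
  then show ?thesis using False unfolding S_const_def by (simp only: if_False)
qed

section \<open>Combining line and sphere\<close>

lemma measurable_ident_sphere_measure [measurable]:
  "(\<lambda>v. v) \<in> measurable (sphere_measure :: 'a::euclidean_space measure) borel"
proof -
  have "(\<lambda>v::'a. v) \<in> measurable (restrict_space borel (sphere 0 1)) borel"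
    by (rule measurable_restrict_space1) simp
  then show ?thesis by (simp cong: measurable_cong_sets add: sets_sphere_measure)
qed

lemma nn_integral_psi_diff_sphere:
  fixes x y :: "'a::euclidean_space"
  assumes \<gamma>: "0 < \<gamma>" "\<gamma> < 2"
  shows "(\<integral>\<^sup>+v. \<integral>\<^sup>+b. ennreal ((psi \<gamma> (x \<bullet> v - b) - psi \<gamma> (y \<bullet> v - b))\<^sup>2) \<partial>lborel \<partial>sphere_measure)
         = ennreal (2 * S_const DIM('a) \<gamma> * norm (x - y) powr \<gamma>)"
proof -
  have pos: "0 < S_const DIM('a) \<gamma>" using \<gamma> by (rule S_const_pos) simp
  have m: "0 < sphere_moment DIM('a) \<gamma>"
  proof -
    have "0 < Gamma ((\<gamma> + 1) / 2)" "0 < Gamma ((real DIM('a) + \<gamma>) / 2)"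
      by (rule Gamma_real_pos; use \<gamma> in \<open>simp add: add_nonneg_pos\<close>)+
    then show ?thesis unfolding sphere_moment_def by (intro divide_pos_pos mult_pos_pos) simp_all
  qed
  have S: "2 * S_const DIM('a) \<gamma> = psi_const \<gamma> * sphere_moment DIM('a) \<gamma>"
    using S_const_eq[OF \<gamma>, of "DIM('a)"] by simp
  \<comment> \<open>The sign is inferred from the product with the positive sphere moment, without
    inspecting the cosine.\<close>
  then have p: "0 \<le> psi_const \<gamma>"
    using pos m by (metis less_eq_real_def mult_pos_pos zero_less_mult_pos2 zero_less_numeral)
  have "(\<integral>\<^sup>+v. \<integral>\<^sup>+b. ennreal ((psi \<gamma> (x \<bullet> v - b) - psi \<gamma> (y \<bullet> v - b))\<^sup>2) \<partial>lborel \<partial>sphere_measure)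
      = (\<integral>\<^sup>+v. ennreal (psi_const \<gamma>) * ennreal (\<bar>(x - y) \<bullet> v\<bar> powr \<gamma>) \<partial>sphere_measure)"
    by (intro nn_integral_cong) (simp add: nn_integral_psi_diff[OF \<gamma>] p ennreal_mult inner_diff_left)
  also have "\<dots> = ennreal (psi_const \<gamma>) * (\<integral>\<^sup>+v. ennreal (\<bar>(x - y) \<bullet> v\<bar> powr \<gamma>) \<partial>sphere_measure)"
    by (rule nn_integral_cmult) measurable
  also have "\<dots> = ennreal (2 * S_const DIM('a) \<gamma> * norm (x - y) powr \<gamma>)"
    unfolding nn_integral_sphere_abs_inner[OF \<gamma>(1)] S using p m by (simp add: mult.assoc flip: ennreal_mult)
  finally show ?thesis .
qed

text \<open>The outer integrals are nonnegative ones, so the equality includes finiteness. The two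
  means are Bochner integrals, and the moment conditions make both converge for almost every (v,
  b).\<close>

theorem theorem4:
  fixes \<gamma> :: real
    and \<mu> \<nu> :: "'a::euclidean_space measure"
    and M :: "'w measure"
    and X Y :: "'w \<Rightarrow> 'a"
  assumes "0 < \<gamma>" and "\<gamma> < 2"
    and "prob_space \<mu>" and "sets \<mu> = sets borel"
    and "prob_space \<nu>" and "sets \<nu> = sets borel"
    and "integrable \<mu> (\<lambda>x. norm x powr \<gamma>)"
    and "integrable \<nu> (\<lambda>x. norm x powr \<gamma>)"
    and "prob_space M"
    and "X \<in> borel_measurable M" and "Y \<in> borel_measurable M"
    and "distr M (borel \<Otimes>\<^sub>M borel) (\<lambda>\<omega>. (X \<omega>, Y \<omega>)) = \<mu> \<Otimes>\<^sub>M \<nu>"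
  shows "ennreal ((energy_distance \<gamma> \<mu> \<nu>)\<^sup>2) =
           ennreal (1 / S_const DIM('a) \<gamma>) *
             (\<integral>\<^sup>+ v. \<integral>\<^sup>+ b.
                ennreal (((\<integral>\<omega>. psi \<gamma> (X \<omega> \<bullet> v - b) \<partial>M) - (\<integral>\<omega>. psi \<gamma> (Y \<omega> \<bullet> v - b) \<partial>M))\<^sup>2)
              \<partial>lborel \<partial>sphere_measure)"
proof -
  note \<gamma> = \<open>0 < \<gamma>\<close> \<open>\<gamma> < 2\<close>
  note mu = \<open>prob_space \<mu>\<close> and nu = \<open>prob_space \<nu>\<close>
  note sets_mu[measurable_cong] = \<open>sets \<mu> = sets borel\<close> and sets_nu[measurable_cong] = \<open>sets \<nu> = sets borel\<close>
  note X[measurable] = \<open>X \<in> borel_measurable M\<close> and Y[measurable] = \<open>Y \<in> borel_measurable M\<close>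
  note joint = \<open>distr M (borel \<Otimes>\<^sub>M borel) (\<lambda>\<omega>. (X \<omega>, Y \<omega>)) = \<mu> \<Otimes>\<^sub>M \<nu>\<close>
  interpret M: prob_space \<mu> by (rule mu)
  interpret N: prob_space \<nu> by (rule nu)
  interpret S: finite_measure "sphere_measure :: 'a measure" by (rule finite_measure_sphere_measure)
  interpret SL: pair_sigma_finite "sphere_measure :: 'a measure" "lborel :: real measure" ..
  let ?L = "(sphere_measure :: 'a measure) \<Otimes>\<^sub>M (lborel :: real measure)"
  let ?S = "S_const DIM('a) \<gamma>"
  define g where "g x l = psi \<gamma> (x \<bullet> fst l - snd l)" for x :: 'a and l :: "'a \<times> real"
  \<comment> \<open>The factor \<open>2 * ?S\<close> is the one produced by
    \<open>nn_integral_psi_diff_sphere\<close>; by linearity it comes out of the energy of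
    \<open>k\<close>.\<close>
  define k where "k x y = 2 * ?S * norm (x - y) powr \<gamma>" for x y :: 'a
  have S: "0 < ?S" using \<gamma> by (rule S_const_pos) simp
  have psi_meas[measurable]: "psi \<gamma> \<in> borel_measurable borel"
    unfolding psi_def by measurable
  have fst_L[measurable]: "fst \<in> measurable ?L borel"
    using measurable_compose[OF measurable_fst measurable_ident_sphere_measure] by simp
  have snd_L[measurable]: "snd \<in> borel_measurable ?L"
    using measurable_snd[of "sphere_measure :: 'a measure" "lborel :: real measure"] by simp
  have g_meas: "(\<lambda>z. g (fst z) (snd z)) \<in> borel_measurable (\<mu> \<Otimes>\<^sub>M ?L)" if "sets \<mu> = sets borel" for \<mu>
  proof -
    note that[measurable_cong]
    have "(\<lambda>z. fst (snd z)) \<in> measurable (\<mu> \<Otimes>\<^sub>M ?L) borel" "(\<lambda>z. snd (snd z)) \<in> borel_measurable (\<mu> \<Otimes>\<^sub>M ?L)"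
      "fst \<in> measurable (\<mu> \<Otimes>\<^sub>M ?L) borel"
      using measurable_compose[OF measurable_snd fst_L] measurable_compose[OF measurable_snd snd_L]
        measurable_fst[of \<mu> ?L] that by (simp_all cong: measurable_cong_sets)
    note [measurable] = this
    show ?thesis unfolding g_def by measurable
  qed
  have g_meas': "(\<lambda>z. g (snd z) (fst z)) \<in> borel_measurable (?L \<Otimes>\<^sub>M \<mu>)" if "sets \<mu> = sets borel" for \<mu>
    using measurable_pair_swap[OF g_meas[OF that]] by (simp add: case_prod_beta')
  have g_mean[measurable]: "(\<lambda>l. \<integral>x. g x l \<partial>\<mu>) \<in> borel_measurable ?L" "(\<lambda>l. \<integral>y. g y l \<partial>\<nu>) \<in> borel_measurable ?L"
    using g_meas'[OF sets_mu] g_meas'[OF sets_nu]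
    by (auto intro!: M.borel_measurable_lebesgue_integral N.borel_measurable_lebesgue_integral simp: case_prod_beta')
  have k_eq: "(\<integral>\<^sup>+l. ennreal ((g x l - g y l)\<^sup>2) \<partial>?L) = ennreal (k x y)" for x y
  proof -
    have "(\<lambda>l. ennreal ((g x l - g y l)\<^sup>2)) \<in> borel_measurable ?L"
      unfolding g_def by measurable
    then have "(\<integral>\<^sup>+l. ennreal ((g x l - g y l)\<^sup>2) \<partial>?L)
        = (\<integral>\<^sup>+v. \<integral>\<^sup>+b. ennreal ((g x (v, b) - g y (v, b))\<^sup>2) \<partial>lborel \<partial>sphere_measure)"
      by (rule lborel.nn_integral_fst[symmetric])
    then show ?thesis
      unfolding k_def g_def by (simp add: nn_integral_psi_diff_sphere[OF \<gamma>])
  qed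
  have int: "integrable (\<mu> \<Otimes>\<^sub>M \<nu>) (\<lambda>z. norm (fst z - snd z) powr \<gamma>)"
    "integrable (\<mu> \<Otimes>\<^sub>M \<mu>) (\<lambda>z. norm (fst z - snd z) powr \<gamma>)"
    "integrable (\<nu> \<Otimes>\<^sub>M \<nu>) (\<lambda>z. norm (fst z - snd z) powr \<gamma>)"
    by (rule integrable_norm_diff_powr; fact)+
  have int_k: "integrable (\<mu> \<Otimes>\<^sub>M \<nu>) (\<lambda>z. k (fst z) (snd z))" "integrable (\<mu> \<Otimes>\<^sub>M \<mu>) (\<lambda>z. k (fst z) (snd z))"
    "integrable (\<nu> \<Otimes>\<^sub>M \<nu>) (\<lambda>z. k (fst z) (snd z))"
    unfolding k_def by (intro integrable_mult_right int)+
  define E where "E = 2 * (\<integral>z. norm (fst z - snd z) powr \<gamma> \<partial>(\<mu> \<Otimes>\<^sub>M \<nu>))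
    - (\<integral>z. norm (fst z - snd z) powr \<gamma> \<partial>(\<mu> \<Otimes>\<^sub>M \<mu>)) - (\<integral>z. norm (fst z - snd z) powr \<gamma> \<partial>(\<nu> \<Otimes>\<^sub>M \<nu>))"
  have E_k: "2 * (\<integral>z. k (fst z) (snd z) \<partial>(\<mu> \<Otimes>\<^sub>M \<nu>)) - (\<integral>z. k (fst z) (snd z) \<partial>(\<mu> \<Otimes>\<^sub>M \<mu>))
      - (\<integral>z. k (fst z) (snd z) \<partial>(\<nu> \<Otimes>\<^sub>M \<nu>)) = 2 * ?S * E"
    unfolding k_def E_def by (simp add: right_diff_distrib)
  have sets_eq: "sets \<nu> = sets \<mu>" by (simp add: sets_mu sets_nu)
  have sL: "sigma_finite_measure ?L" by unfold_locales
  have k_nonneg: "0 \<le> k x y" for x y unfolding k_def using S by simp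
  have k_sym: "k x y = k y x" for x y unfolding k_def by (simp add: norm_minus_commute)
  note main = nn_integral_square_mean_diff[OF mu nu sets_eq sL g_meas[OF sets_mu] k_eq k_nonneg k_sym int_k, unfolded E_k]
  \<comment> \<open>Needed because \<open>energy_distance\<close> is a square root, which squaring
    undoes only for a nonnegative radicand.\<close>
  have E_nonneg: "0 \<le> E" using main(2) S by (simp add: zero_le_mult_iff)
  have "(\<integral>(x, x', y, y'). 2 * norm (x - y) powr \<gamma> - norm (x - x') powr \<gamma> - norm (y - y') powr \<gamma>
      \<partial>(\<mu> \<Otimes>\<^sub>M \<mu> \<Otimes>\<^sub>M \<nu> \<Otimes>\<^sub>M \<nu>)) = E"
    unfolding E_def by (rule integral_energy_product[OF mu nu int])
  then have energy: "(energy_distance \<gamma> \<mu> \<nu>)\<^sup>2 = E"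
    unfolding energy_distance_def using E_nonneg by simp
  have distr_X: "distr M borel X = \<mu>"
  proof -
    have "distr M borel X = distr (distr M (borel \<Otimes>\<^sub>M borel) (\<lambda>\<omega>. (X \<omega>, Y \<omega>))) borel fst"
      by (subst distr_distr) (auto simp: comp_def)
    also have "\<dots> = distr (\<mu> \<Otimes>\<^sub>M \<nu>) \<mu> fst" unfolding joint by (rule distr_cong) (simp_all add: sets_mu)
    also have "\<dots> = \<mu>" by (rule N.distr_pair_fst)
    finally show ?thesis .
  qed
  have distr_Y: "distr M borel Y = \<nu>"
  proof -
    have "distr M borel Y = distr (distr M (borel \<Otimes>\<^sub>M borel) (\<lambda>\<omega>. (X \<omega>, Y \<omega>))) borel snd"
      by (subst distr_distr) (auto simp: comp_def)
    also have "\<dots> = distr (\<mu> \<Otimes>\<^sub>M \<nu>) \<nu> snd" unfolding joint by (rule distr_cong) (simp_all add: sets_nu)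
    also have "\<dots> = \<nu>" by (rule distr_pair_snd[OF mu nu])
    finally show ?thesis .
  qed
  have law: "(\<integral>\<omega>. psi \<gamma> (X \<omega> \<bullet> v - b) \<partial>M) = (\<integral>x. g x (v, b) \<partial>\<mu>)"
    "(\<integral>\<omega>. psi \<gamma> (Y \<omega> \<bullet> v - b) \<partial>M) = (\<integral>y. g y (v, b) \<partial>\<nu>)" for v b
    by (subst distr_X[symmetric] distr_Y[symmetric], subst integral_distr; simp add: g_def)+
  have "(\<integral>\<^sup>+ v. \<integral>\<^sup>+ b.
                ennreal (((\<integral>\<omega>. psi \<gamma> (X \<omega> \<bullet> v - b) \<partial>M) - (\<integral>\<omega>. psi \<gamma> (Y \<omega> \<bullet> v - b) \<partial>M))\<^sup>2)
              \<partial>lborel \<partial>sphere_measure)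
      = (\<integral>\<^sup>+l. ennreal (((\<integral>x. g x l \<partial>\<mu>) - (\<integral>y. g y l \<partial>\<nu>))\<^sup>2) \<partial>?L)"
    unfolding law by (rule lborel.nn_integral_fst) measurable
  \<comment> \<open>The 2 in \<open>k\<close> meets the half of the polarization, so exactly
    \<open>?S\<close> is left for the prefactor to cancel.\<close>
  also have "\<dots> = ennreal (2 * ?S * E / 2)" by (rule main(1))
  finally show ?thesis
    unfolding energy using S E_nonneg by (simp flip: ennreal_mult)
qed

end
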